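(* For each of the groups $\mathbb{Z}/11\mathbb{Z}\oplus\mathbb{Z}^2$, $\mathbb{Z}/13\mathbb{Z}\oplus\mathbb{Z}$, $\mathbb{Z}/15\mathbb{Z}\oplus\mathbb{Z}$, $\mathbb{Z}/16\mathbb{Z}\oplus\mathbb{Z}$, $\mathbb{Z}/20\mathbb{Z}\oplus\mathbb{Z}$, $\mathbb{Z}/2\mathbb{Z}\oplus\mathbb{Z}/10\mathbb{Z}\oplus\mathbb{Z}$, $\mathbb{Z}/2\mathbb{Z}\oplus\mathbb{Z}/12\mathbb{Z}\oplus\mathbb{Z}$, and $\mathbb{Z}/2\mathbb{Z}\oplus\mathbb{Z}/14\mathbb{Z}\oplus\mathbb{Z}$, there exist a cubic number field $K$ and an elliptic curve $E$ over $K$ whose Mordell--Weil group $E(K)$ contains a subgroup isomorphic to that group. *)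

theory Defs
  imports Complex_Main "HOL-Algebra.Algebra" "HOL-Algebra.Algebraic_Closure_Type"
begin

section \<open>Cubic number fields\<close>

text \<open>
  Every number field embeds into the complex numbers, so number fields are represented as
  subfields of \<^typ>\<open>complex\<close>. The complex field as a record is
  \<^term>\<open>ring_of_type_algebra :: complex ring\<close>, and \<^term>\<open>\<rat> :: complex set\<close> is its prime field.
\<close>

definition cubic_number_field :: "complex set \<Rightarrow> bool" where
  "cubic_number_field K \<longleftrightarrow>
     subfield K (ring_of_type_algebra :: complex ring) \<and>
     ring.dimension (ring_of_type_algebra :: complex ring) 3 \<rat> K"


section \<open>Elliptic curves in Weierstrass form\<close>

text \<open>
  A value of this type stands for the equation
  \<open>y\<^sup>2 + a\<^sub>1 x y + a\<^sub>3 y = x\<^sup>3 + a\<^sub>2 x\<^sup>2 + a\<^sub>4 x + a\<^sub>6\<close>.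
\<close>

datatype 'a weierstrass =
  Weierstrass (a1: 'a) (a2: 'a) (a3: 'a) (a4: 'a) (a6: 'a)

definition b2 :: "'a::field weierstrass \<Rightarrow> 'a" where
  "b2 E = (a1 E)\<^sup>2 + 4 * a2 E"

definition b4 :: "'a::field weierstrass \<Rightarrow> 'a" where
  "b4 E = 2 * a4 E + a1 E * a3 E"

definition b6 :: "'a::field weierstrass \<Rightarrow> 'a" where
  "b6 E = (a3 E)\<^sup>2 + 4 * a6 E"

definition b8 :: "'a::field weierstrass \<Rightarrow> 'a" where
  "b8 E = (a1 E)\<^sup>2 * a6 E + 4 * a2 E * a6 E - a1 E * a3 E * a4 E + a2 E * (a3 E)\<^sup>2 - (a4 E)\<^sup>2"

definition discriminant :: "'a::field weierstrass \<Rightarrow> 'a" where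
  "discriminant E =
     - (b2 E)\<^sup>2 * b8 E - 8 * (b4 E) ^ 3 - 27 * (b6 E)\<^sup>2 + 9 * b2 E * b4 E * b6 E"

definition elliptic_curve_over :: "'a::field set \<Rightarrow> 'a weierstrass \<Rightarrow> bool" where
  "elliptic_curve_over K E \<longleftrightarrow> set_weierstrass E \<subseteq> K \<and> discriminant E \<noteq> 0"


section \<open>The Mordell--Weil group\<close>

datatype 'a point = Infinity | Affine 'a 'a

fun on_curve :: "'a::field weierstrass \<Rightarrow> 'a point \<Rightarrow> bool" where
  "on_curve E Infinity \<longleftrightarrow> True"
| "on_curve E (Affine x y) \<longleftrightarrow>
     y\<^sup>2 + a1 E * x * y + a3 E * y = x ^ 3 + a2 E * x\<^sup>2 + a4 E * x + a6 E"

definition rational_points :: "'a::field set \<Rightarrow> 'a weierstrass \<Rightarrow> 'a point set" where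
  "rational_points K E = {P. on_curve E P \<and> set_point P \<subseteq> K}"

text \<open>
  The chord-tangent law. The inverse of \<open>(x, y)\<close> is \<open>(x, - y - a\<^sub>1 x - a\<^sub>3)\<close>, so the first test
  below says that the two points are mutually inverse. If they are not but share their abscissa,
  they coincide, and \<open>l\<close> is the slope of the tangent line.
\<close>

fun point_add :: "'a::field weierstrass \<Rightarrow> 'a point \<Rightarrow> 'a point \<Rightarrow> 'a point" where
  "point_add E Infinity Q = Q"
| "point_add E P Infinity = P"
| "point_add E (Affine x1 y1) (Affine x2 y2) =
     (if x1 = x2 \<and> y1 + y2 + a1 E * x2 + a3 E = 0 then Infinity
      else
        let l = (if x1 = x2
                 then (3 * x1\<^sup>2 + 2 * a2 E * x1 + a4 E - a1 E * y1) / (2 * y1 + a1 E * x1 + a3 E)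
                 else (y2 - y1) / (x2 - x1));
            x3 = l\<^sup>2 + a1 E * l - a2 E - x1 - x2
        in Affine x3 (- (y1 + l * (x3 - x1)) - a1 E * x3 - a3 E))"

definition mordell_weil_group :: "'a::field set \<Rightarrow> 'a weierstrass \<Rightarrow> 'a point monoid" where
  "mordell_weil_group K E =
     \<lparr>carrier = rational_points K E, monoid.mult = point_add E, one = Infinity\<rparr>"


section \<open>Subgroups of a given isomorphism type\<close>

definition has_subgroup_isomorphic_to :: "('a, 'c) monoid_scheme \<Rightarrow> ('b, 'd) monoid_scheme \<Rightarrow> bool"
  where
  "has_subgroup_isomorphic_to G A \<longleftrightarrow> (\<exists>H. subgroup H G \<and> G\<lparr>carrier := H\<rparr> \<cong> A)"

end

theory Submission
  imports Defs
begin

text \<open>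
  For each group an explicit cubic field \<open>K = \<rat>(\<alpha>)\<close>, a curve \<open>y\<^sup>2 = x\<^sup>3 + a x\<^sup>2 + b x + c\<close> over \<open>K\<close>, a
  torsion point (or two) of the required order and points \<open>P\<^sub>i\<close> are exhibited. To see that the \<open>P\<^sub>i\<close> are
  independent modulo torsion, it suffices to know the 2-torsion of \<open>E(K)\<close> and that no nontrivial
  sum of some of the generators is of the form \<open>2 R\<close>: then a relation between the generators with an
  odd coefficient is impossible, and one with even coefficients can be divided by 2. If \<open>2 R\<close> has
  abscissa \<open>x\<close>, then the abscissa of \<open>R\<close> is a root in \<open>K\<close> of a monic quartic polynomial depending on
  \<open>x\<close>. Such roots are excluded by reducing modulo a prime of degree one of \<open>K\<close>.
\<close>

section \<open>The group law\<close>

text \<open>Neither the full torsion subgroup nor the rank of E(K) is computed. Only the classes of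
  the exhibited generators in E(K)/2E(K) matter, and their sums are tested one by one, so no height
  pairing enters. Torsion of odd order lies in 2E(K) and drops out of the tests; torsion of even
  order has to be tested along with the points of infinite order. The ring of integers of K is
  avoided in favour of Z[\<alpha>], which may be smaller. A root in K of a monic polynomial over
  Z[\<alpha>] may then have a denominator divisible by p, and reducing it modulo p needs an
  argument. For this a simple root r of the defining cubic modulo p is lifted modulo a high power of
  p: it approximates an embedding of K into the p-adic numbers, where a root of a monic polynomial
  is integral. All concrete claims are identities and congruences between integer triples. No
  division in K occurs in them: slopes are supplied as l / d and verified by cross
  multiplication.\<close>

locale short_weierstrass =
  fixes a b c :: "'a::field_char_0"
  assumes nonsingular: "x ^ 3 + a * x\<^sup>2 + b * x + c = 0 \<Longrightarrow> 3 * x\<^sup>2 + 2 * a * x + b \<noteq> 0"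
begin

abbreviation E :: "'a weierstrass" where "E \<equiv> Weierstrass 0 a 0 b c"

abbreviation f :: "'a \<Rightarrow> 'a" where "f x \<equiv> x ^ 3 + a * x\<^sup>2 + b * x + c"

abbreviation add :: "'a point \<Rightarrow> 'a point \<Rightarrow> 'a point" (infixl \<open>\<boxplus>\<close> 65) where
  "P \<boxplus> Q \<equiv> point_add E P Q"

section \<open>Chords and tangents\<close>

definition slope :: "'a \<Rightarrow> 'a \<Rightarrow> 'a \<Rightarrow> 'a \<Rightarrow> 'a" where
  "slope x1 y1 x2 y2 =
     (if x1 = x2 then (3 * x1\<^sup>2 + 2 * a * x1 + b) / (2 * y1) else (y2 - y1) / (x2 - x1))"

lemma add_affine:
  assumes "\<not> (x1 = x2 \<and> y1 + y2 = 0)" and "l = slope x1 y1 x2 y2" and "x3 = l\<^sup>2 - a - x1 - x2"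
  shows "Affine x1 y1 \<boxplus> Affine x2 y2 = Affine x3 (- (y1 + l * (x3 - x1)))"
  using assms by (auto simp: slope_def Let_def)

lemma add_opposite [simp]: "Affine x y \<boxplus> Affine x (- y) = Infinity"
  by simp

lemma same_abscissa:
  assumes "y1\<^sup>2 = f x" "y2\<^sup>2 = f x" "y1 + y2 \<noteq> 0"
  shows "y1 = y2" and "y1 \<noteq> 0"
proof -
  have "(y1 - y2) * (y1 + y2) = y1\<^sup>2 - y2\<^sup>2" by (simp add: algebra_simps power2_eq_square)
  then have "(y1 - y2) * (y1 + y2) = 0" using assms(1,2) by simp
  then show "y1 = y2" using assms(3) by simp
  then show "y1 \<noteq> 0" using assms(3) by auto
qed

text \<open>For the line L the cubic f - L^2 has the roots x1 and x2, and its coefficient a - l^2 at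
  t^2 forces the third root to be x3. From here on chord and tangent need no separate
  treatment.\<close>

lemma line_through:
  assumes P: "y1\<^sup>2 = f x1" and Q: "y2\<^sup>2 = f x2" and nopp: "\<not> (x1 = x2 \<and> y1 + y2 = 0)"
    and l: "l = slope x1 y1 x2 y2" and x3: "x3 = l\<^sup>2 - a - x1 - x2"
  shows "f t - (y1 + l * (t - x1))\<^sup>2 = (t - x1) * (t - x2) * (t - x3)"
    and "y2 = y1 + l * (x2 - x1)"
proof -
  \<comment> \<open>The second equation is f - L^2 divided by t - x1 and evaluated at x2; for a
    tangent it says that x1 is a double root.\<close>
  have *: "y2 = y1 + l * (x2 - x1) \<and>
    x2\<^sup>2 + x2 * x1 + x1\<^sup>2 + a * (x2 + x1) + b - 2 * y1 * l - l\<^sup>2 * (x2 - x1) = 0"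
  proof (cases "x1 = x2")
    case True
    with nopp have "y1 + y2 \<noteq> 0" by simp
    with P Q True have "y1 = y2" "y1 \<noteq> 0" using same_abscissa by metis+
    then have "l * (2 * y1) = 3 * x1\<^sup>2 + 2 * a * x1 + b" using l True by (simp add: slope_def)
    with True \<open>y1 = y2\<close> show ?thesis by (simp add: algebra_simps power2_eq_square)
  next
    case False
    then have l': "l * (x2 - x1) = y2 - y1" using l by (simp add: slope_def)
    then have y2: "y2 = y1 + l * (x2 - x1)" by simp
    have "(x2 - x1) * (x2\<^sup>2 + x2 * x1 + x1\<^sup>2 + a * (x2 + x1) + b - 2 * y1 * l - l\<^sup>2 * (x2 - x1))
      = (f x2 - (y1 + l * (x2 - x1))\<^sup>2) - (f x1 - y1\<^sup>2)"
      by (simp add: algebra_simps power2_eq_square power3_eq_cube)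
    also have "\<dots> = 0" using P Q y2 by simp
    finally show ?thesis using False y2 by simp
  qed
  then show "y2 = y1 + l * (x2 - x1)" by simp
  show "f t - (y1 + l * (t - x1))\<^sup>2 = (t - x1) * (t - x2) * (t - x3)"
  proof -
    have "f t - (y1 + l * (t - x1))\<^sup>2 - (t - x1) * (t - x2) * (t - x3) = (f x1 - y1\<^sup>2) + (t - x1) *
      (x2\<^sup>2 + x2 * x1 + x1\<^sup>2 + a * (x2 + x1) + b - 2 * y1 * l - l\<^sup>2 * (x2 - x1))"
      unfolding x3 by (simp add: algebra_simps power2_eq_square power3_eq_cube)
    then show ?thesis using * P by simp
  qed
qed

lemma on_curve_affine [simp]: "on_curve E (Affine x y) \<longleftrightarrow> y\<^sup>2 = f x"
  by simp

lemma on_curve_add: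
  assumes "on_curve E P" "on_curve E Q" shows "on_curve E (P \<boxplus> Q)"
proof (cases P; cases Q)
  fix x1 y1 x2 y2 assume PQ: "P = Affine x1 y1" "Q = Affine x2 y2"
  show ?thesis
  proof (cases "x1 = x2 \<and> y1 + y2 = 0")
    case False
    define l where "l = slope x1 y1 x2 y2"
    define x3 where "x3 = l\<^sup>2 - a - x1 - x2"
    have "f x3 - (y1 + l * (x3 - x1))\<^sup>2 = 0"
      using line_through(1)[of y1 x1 y2 x2 l x3 x3] assms PQ False l_def x3_def by simp
    moreover have "P \<boxplus> Q = Affine x3 (- (y1 + l * (x3 - x1)))"
      using add_affine[OF False l_def x3_def] PQ by simp
    ultimately show ?thesis by (simp only: on_curve_affine power2_minus) simp
  qed (auto simp: PQ)
qed (use assms in auto)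

lemma add_commute:
  assumes "on_curve E P" "on_curve E Q" shows "P \<boxplus> Q = Q \<boxplus> P"
proof (cases P; cases Q)
  fix x1 y1 x2 y2 assume PQ: "P = Affine x1 y1" "Q = Affine x2 y2"
  show ?thesis
  proof (cases "x1 = x2 \<and> y1 + y2 = 0")
    case True then show ?thesis using PQ by (simp add: add.commute)
  next
    case False
    define l where "l = slope x1 y1 x2 y2"
    define x3 where "x3 = l\<^sup>2 - a - x1 - x2"
    have "l = slope x2 y2 x1 y1"
    proof (cases "x1 = x2")
      case True then show ?thesis
        using False assms PQ same_abscissa(1)[of y1 x1 y2] by (auto simp: slope_def l_def)
    next
      case False
      then have "x2 - x1 \<noteq> 0" "x1 - x2 \<noteq> 0" by auto
      then show ?thesis unfolding l_def slope_def using False by (simp add: field_simps)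
    qed
    moreover have "y2 = y1 + l * (x2 - x1)"
      using line_through(2)[of y1 x1 y2 x2 l x3] assms PQ False l_def x3_def by simp
    moreover have "\<not> (x2 = x1 \<and> y2 + y1 = 0)" "x3 = l\<^sup>2 - a - x2 - x1"
      using False x3_def by (auto simp: add.commute)
    moreover have "y1 + l * (x3 - x1) = y1 + l * (x2 - x1) + l * (x3 - x2)"
      by (simp add: algebra_simps)
    ultimately show ?thesis
      using add_affine[OF False l_def x3_def] add_affine[of x2 x1 y2 y1 l x3] PQ by metis
  qed
qed auto

text \<open>The line through -B and B + C is the mirror image of the line through B and C, so its
  third point is -C. The delicate case is x3 = x1, where the mirrored line has to be recognised as a
  tangent.\<close>

lemma add_cancel_opposite:
  assumes B: "y1\<^sup>2 = f x1" and C: "on_curve E C"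
  shows "Affine x1 (- y1) \<boxplus> (Affine x1 y1 \<boxplus> C) = C"
proof (cases C)
  case Infinity then show ?thesis by simp
next
  case (Affine x2 y2)
  show ?thesis
  proof (cases "x1 = x2 \<and> y1 + y2 = 0")
    case True
    then have "y2 = - y1" by (simp add: eq_neg_iff_add_eq_0 add.commute)
    with True Affine show ?thesis by simp
  next
    case False
    define l where "l = slope x1 y1 x2 y2"
    define x3 where "x3 = l\<^sup>2 - a - x1 - x2"
    define y3 where "y3 = y1 + l * (x3 - x1)"
    note line = line_through[of y1 x1 y2 x2 l x3, OF B _ False l_def x3_def]
    have C': "y2\<^sup>2 = f x2" using C Affine by simp
    have sum: "Affine x1 y1 \<boxplus> C = Affine x3 (- y3)"
      using add_affine[OF False l_def x3_def] Affine y3_def by simp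
    \<comment> \<open>Here f - L^2 = (t - x1)^2 (t - x2). That its derivative vanishes at x1 is read
      off from the values at x1 + 1 and x1 - 1.\<close>
    have dbl: "3 * x1\<^sup>2 + 2 * a * x1 + b = 2 * y1 * l" if "x3 = x1"
    proof -
      have "f (x1 + 1) - (y1 + l)\<^sup>2 = x1 + 1 - x2" "f (x1 - 1) - (y1 - l)\<^sup>2 = x1 - 1 - x2"
        using line(1)[OF C', of "x1 + 1"] line(1)[OF C', of "x1 - 1"] that by simp_all
      moreover have "2 * (3 * x1\<^sup>2 + 2 * a * x1 + b - 2 * y1 * l)
        = (f (x1 + 1) - (y1 + l)\<^sup>2) - (f (x1 - 1) - (y1 - l)\<^sup>2) - 2"
        by (simp add: algebra_simps power2_eq_square power3_eq_cube)
      ultimately have "2 * (3 * x1\<^sup>2 + 2 * a * x1 + b - 2 * y1 * l) = 0" by simp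
      then show ?thesis unfolding mult_eq_0_iff by simp
    qed
    \<comment> \<open>Opposite points would give y1 = 0 on a tangent line, so f and its derivative
      would both vanish at x1. This is where nonsingularity enters.\<close>
    have nopp: "\<not> (x1 = x3 \<and> - y1 + - y3 = 0)"
    proof
      assume *: "x1 = x3 \<and> - y1 + - y3 = 0"
      then have "2 * y1 = 0" by (auto simp: y3_def)
      then have "y1 = 0" by simp
      then show False using nonsingular[of x1] B dbl * by simp
    qed
    have slope: "- l = slope x1 (- y1) x3 (- y3)"
    proof (cases "x1 = x3")
      case True
      then have "y1 \<noteq> 0" using nopp by (auto simp: y3_def)
      then show ?thesis using dbl True by (simp add: slope_def)
    next
      case False
      then show ?thesis by (simp add: slope_def y3_def field_simps)
    qed
    have "x2 = (- l)\<^sup>2 - a - x1 - x3" by (simp add: x3_def)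
    then have "Affine x1 (- y1) \<boxplus> Affine x3 (- y3) = Affine x2 (- (- y1 + - l * (x2 - x1)))"
      by (rule add_affine[OF nopp slope])
    also have "- (- y1 + - l * (x2 - x1)) = y2" using line(2)[OF C'] by simp
    finally show ?thesis using sum Affine by simp
  qed
qed

text \<open>
  Associativity: let \<open>L\<close> and \<open>M\<close> be the lines through \<open>A\<close>, \<open>B\<close> and through \<open>A + B\<close>, \<open>C\<close>, with slopes
  \<open>l\<close> and \<open>m\<close>. The quadratic polynomial \<open>q = L + (t - x\<^sub>A) (t - x\<^sub>B) / (l + m)\<close> satisfies
  \<open>f - q\<^sup>2 = (t - x\<^sub>A) (t - x\<^sub>B) (t - x\<^sub>C) r\<close> with \<open>r\<close> linear, and the root of \<open>r\<close> is the abscissa of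
  \<open>(A + B) + C\<close>. Since \<open>q\<close> is determined by this symmetric condition, so is \<open>(A + B) + C\<close>.
\<close>

definition F :: "'a poly" where "F = [:c, b, a, 1:]"

definition interpolates :: "'a poly \<Rightarrow> 'a poly \<Rightarrow> ('a \<times> 'a) \<Rightarrow> ('a \<times> 'a) \<Rightarrow> ('a \<times> 'a) \<Rightarrow> bool" where
  "interpolates q r A B C \<longleftrightarrow> degree q \<le> 2 \<and>
     poly q (fst A) = snd A \<and> poly q (fst B) = snd B \<and> poly q (fst C) = snd C \<and>
     F - q\<^sup>2 = [:- fst A, 1:] * ([:- fst B, 1:] * ([:- fst C, 1:] * r))"

text \<open>If w = \<open>coeff q 2\<close> is nonzero, F - q^2 has degree 4 and leading coefficient
  -w^2, so the linear factor r has the root \<open>coeff r 0\<close> / w^2. If w = 0, the three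
  points lie on a line and add up to \<open>Infinity\<close>.\<close>

definition fourth_point :: "'a poly \<Rightarrow> 'a poly \<Rightarrow> 'a point" where
  "fourth_point q r = (if coeff q 2 = 0 then Infinity
     else let x = coeff r 0 / (coeff q 2)\<^sup>2 in Affine x (- poly q x))"

definition opposite :: "('a \<times> 'a) \<Rightarrow> ('a \<times> 'a) \<Rightarrow> bool" where
  "opposite A B \<longleftrightarrow> fst A = fst B \<and> snd A + snd B = 0"

lemma interpolates_rotate: "interpolates q r A B C \<Longrightarrow> interpolates q r B C A"
  unfolding interpolates_def by (simp only: mult_ac)

lemma ordinate_nonzero:
  assumes "\<not> opposite A B" "fst A = fst B" "(snd A)\<^sup>2 = f (fst A)" "(snd B)\<^sup>2 = f (fst B)"
  shows "snd B \<noteq> 0"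
  using assms same_abscissa[of "snd A" "fst B" "snd B"] unfolding opposite_def by metis

text \<open>The product of q' - q and q' + q is divisible by all three linear factors, and each is
  shown to divide q' - q. At a new abscissa this holds because q' - q vanishes there; at a repeated
  one q' + q takes the value 2 y, nonzero since the points coincide without being opposite. Three
  factors exceed the degree of q' - q.\<close>

lemma interpolates_unique:
  assumes i: "interpolates q r A B C" and i': "interpolates q' r' A B C"
    and nopp: "\<not> opposite A B" "\<not> opposite B C" "\<not> opposite A C"
    and curve: "(snd A)\<^sup>2 = f (fst A)" "(snd B)\<^sup>2 = f (fst B)" "(snd C)\<^sup>2 = f (fst C)"
  shows "q = q'" and "r = r'"
proof -
  define d s where "d = q' - q" and "s = q' + q"
  have prod: "d * s = [:- fst A, 1:] * ([:- fst B, 1:] * ([:- fst C, 1:] * (r - r')))"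
  proof -
    have "d * s = (F - q\<^sup>2) - (F - q'\<^sup>2)" by (simp add: d_def s_def algebra_simps power2_eq_square)
    also have "\<dots> = [:- fst A, 1:] * ([:- fst B, 1:] * ([:- fst C, 1:] * (r - r')))"
      using i i' by (simp only: interpolates_def right_diff_distrib)
    finally show ?thesis .
  qed
  have s_val: "poly s (fst A) = 2 * snd A" "poly s (fst B) = 2 * snd B" "poly s (fst C) = 2 * snd C"
    and d_val: "poly d (fst A) = 0" "poly d (fst B) = 0" "poly d (fst C) = 0"
    using i i' by (auto simp: interpolates_def d_def s_def)
  obtain d1 where d1: "d = [:- fst A, 1:] * d1"
    using d_val(1) by (auto simp: poly_eq_0_iff_dvd elim: dvdE)
  have p1: "d1 * s = [:- fst B, 1:] * ([:- fst C, 1:] * (r - r'))"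
    using prod unfolding d1 mult.assoc by (metis mult_left_cancel pCons_eq_0_iff zero_neq_one)
  have "poly d1 (fst B) = 0"
  proof (cases "fst A = fst B")
    case True
    then have "snd B \<noteq> 0" using ordinate_nonzero nopp curve by blast
    moreover have "poly (d1 * s) (fst B) = 0" unfolding p1 by simp
    ultimately show ?thesis using s_val by simp
  qed (use d_val(2) in \<open>simp add: d1\<close>)
  then obtain d2 where d2: "d1 = [:- fst B, 1:] * d2"
    by (auto simp: poly_eq_0_iff_dvd elim: dvdE)
  have p2: "d2 * s = [:- fst C, 1:] * (r - r')"
    using p1 unfolding d2 mult.assoc by (metis mult_left_cancel pCons_eq_0_iff zero_neq_one)
  have "poly d2 (fst C) = 0"
  proof (cases "fst A = fst C \<or> fst B = fst C")
    case True
    then have "snd C \<noteq> 0" using ordinate_nonzero nopp curve by blast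
    moreover have "poly (d2 * s) (fst C) = 0" unfolding p2 by simp
    ultimately show ?thesis using s_val by simp
  qed (use d_val(3) in \<open>auto simp: d1 d2\<close>)
  then obtain d3 where d3: "d2 = [:- fst C, 1:] * d3"
    by (auto simp: poly_eq_0_iff_dvd elim: dvdE)
  have "d3 = 0"
  proof (rule ccontr)
    assume "d3 \<noteq> 0"
    have "[:- x, 1:] * p \<noteq> 0 \<and> degree ([:- x, 1:] * p) = Suc (degree p)" if "p \<noteq> 0" for x and p :: "'a poly"
      using that degree_mult_eq[of "[:- x, 1:]" p] by (simp only: mult_eq_0_iff pCons_eq_0_iff) simp
    with \<open>d3 \<noteq> 0\<close> have "degree d \<ge> 3" unfolding d1 d2 d3 by (simp del: mult_pCons_left)
    moreover have "degree d \<le> 2" using i i' unfolding d_def interpolates_def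
      by (intro degree_diff_le) auto
    ultimately show False by simp
  qed
  then have d: "d2 = 0" "d1 = 0" "d = 0" by (simp_all add: d1 d2 d3)
  then show "q = q'" by (simp add: d_def)
  have "[:- fst C, 1:] * (r - r') = 0" using p2 d by simp
  then show "r = r'" unfolding mult_eq_0_iff by simp
qed

lemma add_add_eq_fourth_point:
  assumes A: "y1\<^sup>2 = f x1" and B: "y2\<^sup>2 = f x2" and C: "y4\<^sup>2 = f x4"
    and nopp: "\<not> opposite (x1, y1) (x2, y2)" "\<not> opposite (x2, y2) (x4, y4)"
      "\<not> opposite (x1, y1) (x4, y4)"
  obtains q r where "interpolates q r (x1, y1) (x2, y2) (x4, y4)"
    and "(Affine x1 y1 \<boxplus> Affine x2 y2) \<boxplus> Affine x4 y4 = fourth_point q r"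
proof -
  have AB: "\<not> (x1 = x2 \<and> y1 + y2 = 0)" using nopp by (simp add: opposite_def)
  define l where "l = slope x1 y1 x2 y2"
  define x3 where "x3 = l\<^sup>2 - a - x1 - x2"
  define y3 where "y3 = y1 + l * (x3 - x1)"
  note L = line_through[OF A B AB l_def x3_def]
  have S: "Affine x1 y1 \<boxplus> Affine x2 y2 = Affine x3 (- y3)"
    using add_affine[OF AB l_def x3_def] y3_def by simp
  have S': "(- y3)\<^sup>2 = f x3" using L(1)[of x3] unfolding y3_def power2_minus by simp
  define p where "p = [:y1 - l * x1, l:]"
  have p: "poly p t = y1 + l * (t - x1)" for t by (simp add: p_def algebra_simps)
  have poly_F: "poly F t = f t" for t
    by (simp add: F_def algebra_simps power2_eq_square power3_eq_cube)
  show thesis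
  proof (cases "x3 = x4 \<and> - y3 + y4 = 0")
    \<comment> \<open>C is the third point on the line through A and B, so the line itself
      interpolates and r = 1.\<close>
    case True
    have "poly (F - p\<^sup>2) = poly ([:- x1, 1:] * ([:- x2, 1:] * ([:- x4, 1:] * 1)))"
      using L(1) True by (simp add: fun_eq_iff poly_F p algebra_simps)
    then have "interpolates p 1 (x1, y1) (x2, y2) (x4, y4)"
      using True L(2) unfolding interpolates_def poly_eq_poly_eq_iff
      by (auto simp: p p_def y3_def algebra_simps)
    moreover have "fourth_point p 1 = Infinity"
      by (simp add: fourth_point_def p_def numeral_2_eq_2)
    ultimately show thesis using that S True by simp
  next
    case False
    define m where "m = slope x3 (- y3) x4 y4"
    define x5 where "x5 = m\<^sup>2 - a - x3 - x4"
    note M = line_through[OF S' C False m_def x5_def]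
    have D: "(Affine x1 y1 \<boxplus> Affine x2 y2) \<boxplus> Affine x4 y4 = Affine x5 (- (- y3 + m * (x5 - x3)))"
      unfolding S by (rule add_affine[OF False m_def x5_def])
    \<comment> \<open>Let M be the second line. M^2 - L^2 is t - x3 times the right side, and M + L
      = (m + l) (t - x3) because M and L have opposite values at x3. Instead of cancelling t - x3,
      the two sides are compared at x3 + 1, where it equals 1; their difference is affine in t with
      slope x1 + x2 + x3 + a - l^2 = 0.\<close>
    have diff: "(m + l) * ((- y3 + m * (t - x3)) - (y1 + l * (t - x1)))
      = (t - x1) * (t - x2) - (t - x4) * (t - x5)" for t
    proof -
      have y1: "y1 + l * (t - x1) = y3 + l * (t - x3)" for t
        by (simp add: y3_def algebra_simps)
      have "(m + l) * (m - l - 2 * y3)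
        = (f (x3 + 1) - (y3 + l)\<^sup>2) - (f (x3 + 1) - (- y3 + m)\<^sup>2)"
        by (simp add: algebra_simps power2_eq_square)
      also have "\<dots> = (x3 + 1 - x1) * (x3 + 1 - x2) - (x3 + 1 - x4) * (x3 + 1 - x5)"
        using L(1)[of "x3 + 1"] M(1)[of "x3 + 1"] unfolding y1 by simp
      finally have "(m + l) * (m - l - 2 * y3)
        = (x3 + 1 - x1) * (x3 + 1 - x2) - (x3 + 1 - x4) * (x3 + 1 - x5)" .
      moreover have "(m + l) * ((- y3 + m * (t - x3)) - (y3 + l * (t - x3)))
          - ((t - x1) * (t - x2) - (t - x4) * (t - x5))
        = (m + l) * (m - l - 2 * y3)
          - ((x3 + 1 - x1) * (x3 + 1 - x2) - (x3 + 1 - x4) * (x3 + 1 - x5))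
          + (t - x3 - 1) * (x1 + x2 + x3 + a - l\<^sup>2)"
        by (simp add: x5_def algebra_simps power2_eq_square)
      moreover have "x1 + x2 + x3 + a - l\<^sup>2 = 0" by (simp add: x3_def)
      ultimately show ?thesis unfolding y1 by simp
    qed
    \<comment> \<open>If m = -l, then C has the abscissa of A or B and lies on the mirror image of
      L, hence is opposite to one of them.\<close>
    have "m + l \<noteq> 0"
    proof
      assume 0: "m + l = 0"
      then have "(x4 - x1) * (x4 - x2) = 0" using diff[of x4] by simp
      moreover have "m = - l" using 0 by (simp add: eq_neg_iff_add_eq_0)
      then have "y4 = - (y1 + l * (x4 - x1))" using M(2) by (simp add: y3_def algebra_simps)
      ultimately show False using nopp L(2) by (auto simp: opposite_def)
    qed
    define w where "w = 1 / (m + l)"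
    have wml: "w * (m + l) = 1" using \<open>m + l \<noteq> 0\<close> by (simp add: w_def)
    define q where "q = p + smult w ([:- x1, 1:] * [:- x2, 1:])"
    define r where "r = [:w\<^sup>2 * x5, - (w\<^sup>2):]"
    have q1: "poly q t = y1 + l * (t - x1) + w * ((t - x1) * (t - x2))" for t
      by (simp add: q_def p algebra_simps)
    have q2: "poly q t = - y3 + m * (t - x3) + w * ((t - x4) * (t - x5))" for t
    proof -
      have "(- y3 + m * (t - x3)) - (y1 + l * (t - x1))
        = w * ((m + l) * ((- y3 + m * (t - x3)) - (y1 + l * (t - x1))))"
        using wml by (simp only: mult.assoc[symmetric] mult_1_left)
      also have "\<dots> = w * ((t - x1) * (t - x2)) - w * ((t - x4) * (t - x5))"
        by (simp only: diff right_diff_distrib[of w])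
      finally show ?thesis unfolding q1 by (simp add: diff_eq_eq)
    qed
    have "f t - (poly q t)\<^sup>2 = (t - x1) * ((t - x2) * ((t - x4) * (w\<^sup>2 * x5 - w\<^sup>2 * t)))" for t
    proof -
      define u v where "u = y1 + l * (t - x1)" and "v = - y3 + m * (t - x3)"
      define d e where "d = (t - x1) * (t - x2)" and "e = (t - x4) * (t - x5)"
      have "u + v = (m + l) * (t - x3)" by (simp add: u_def v_def y3_def algebra_simps)
      then have uv: "t - x3 = w * (u + v)" using wml by (simp add: mult.assoc[symmetric])
      have v: "v = u + w * d - w * e"
        using q1[of t] q2[of t] by (simp add: u_def v_def d_def e_def eq_diff_eq)
      have "f t - (poly q t)\<^sup>2 = (f t - u\<^sup>2) - 2 * w * u * d - (w * d)\<^sup>2"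
        unfolding q1 by (simp add: u_def d_def algebra_simps power2_eq_square)
      also have "f t - u\<^sup>2 = d * (w * (u + v))" using L(1)[of t] by (simp add: u_def d_def uv)
      also have "d * (w * (u + v)) - 2 * w * u * d - (w * d)\<^sup>2 = - (w\<^sup>2 * (d * e))"
        unfolding v by (simp add: algebra_simps power2_eq_square)
      finally show ?thesis by (simp add: d_def e_def algebra_simps)
    qed
    then have "poly (F - q\<^sup>2) = poly ([:- x1, 1:] * ([:- x2, 1:] * ([:- x4, 1:] * r)))"
      by (simp add: fun_eq_iff poly_F r_def algebra_simps)
    moreover have "degree q \<le> 2" unfolding q_def
      by (intro degree_add_le) (auto simp: p_def)
    ultimately have "interpolates q r (x1, y1) (x2, y2) (x4, y4)"
      unfolding interpolates_def poly_eq_poly_eq_iff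
      using q1[of x1] q1[of x2] q2[of x4] L(2) M(2) by simp
    moreover have "coeff q 2 = w" by (simp add: q_def p_def numeral_2_eq_2)
    then have "fourth_point q r = Affine x5 (- (- y3 + m * (x5 - x3)))"
      using wml q2[of x5] by (auto simp: fourth_point_def r_def Let_def)
    ultimately show thesis using that D by simp
  qed
qed

lemma add_assoc:
  assumes A: "on_curve E A" and B: "on_curve E B" and C: "on_curve E C"
  shows "(A \<boxplus> B) \<boxplus> C = A \<boxplus> (B \<boxplus> C)"
proof (cases "A = Infinity \<or> B = Infinity \<or> C = Infinity")
  case True
  have "P \<boxplus> Infinity = P" for P by (cases P) auto
  with True show ?thesis by auto
next
  case False
  then obtain x1 y1 x2 y2 x3 y3
    where eqs: "A = Affine x1 y1" "B = Affine x2 y2" "C = Affine x3 y3"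
    by (metis point.exhaust)
  note oncurve = A[unfolded eqs on_curve_affine] B[unfolded eqs on_curve_affine] C[unfolded eqs on_curve_affine]
  note comm = add_commute on_curve_add A B C
  \<comment> \<open>Interpolation is unique only if no two of the points are opposite; the other
    cases reduce to \<open>add_cancel_opposite\<close> by commutativity.\<close>
  consider "opposite (x1, y1) (x2, y2)" | "opposite (x2, y2) (x3, y3)" | "opposite (x1, y1) (x3, y3)"
    | "\<not> opposite (x1, y1) (x2, y2)" "\<not> opposite (x2, y2) (x3, y3)" "\<not> opposite (x1, y1) (x3, y3)"
    by blast
  then show ?thesis
  proof cases
    case 1
    then have [simp]: "x1 = x2" "y1 = - y2" by (auto simp: opposite_def eq_neg_iff_add_eq_0)
    show ?thesis using add_cancel_opposite[OF oncurve(2) C] eqs by simp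
  next
    case 2
    then have [simp]: "x3 = x2" "y3 = - y2"
      by (auto simp: opposite_def eq_neg_iff_add_eq_0 add.commute)
    have "(A \<boxplus> B) \<boxplus> C = C \<boxplus> (B \<boxplus> A)" using comm by metis
    also have "\<dots> = A" using add_cancel_opposite[OF oncurve(2) A] eqs by simp
    finally show ?thesis using eqs by simp
  next
    case 3
    then have [simp]: "x3 = x1" "y3 = - y1"
      by (auto simp: opposite_def eq_neg_iff_add_eq_0 add.commute)
    have "(A \<boxplus> B) \<boxplus> C = C \<boxplus> (A \<boxplus> B)" using comm by metis
    also have "\<dots> = B" using add_cancel_opposite[OF oncurve(1) B] eqs by simp
    also have "\<dots> = A \<boxplus> (C \<boxplus> B)" using add_cancel_opposite[of "- y1" x1 B] oncurve(1) B eqs by simp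
    finally show ?thesis using comm by metis
  next
    case 4
    then have opp: "\<not> opposite (x3, y3) (x1, y1)" "\<not> opposite (x2, y2) (x1, y1)"
      by (auto simp: opposite_def add.commute)
    obtain q r where qr: "interpolates q r (x1, y1) (x2, y2) (x3, y3)" "(A \<boxplus> B) \<boxplus> C = fourth_point q r"
      using add_add_eq_fourth_point[OF oncurve 4] eqs by metis
    obtain q' r' where qr': "interpolates q' r' (x2, y2) (x3, y3) (x1, y1)" "(B \<boxplus> C) \<boxplus> A = fourth_point q' r'"
      using add_add_eq_fourth_point[OF oncurve(2,3,1) 4(2) opp] eqs by metis
    have "q = q'" "r = r'"
      using interpolates_unique[OF interpolates_rotate[OF qr(1)] qr'(1) 4(2) opp] oncurve by simp_all
    then show ?thesis using qr(2) qr'(2) comm by metis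
  qed
qed

end

section \<open>Cubic fields\<close>

type_synonym triple = "int \<times> int \<times> int"

fun ev :: "triple \<Rightarrow> 'a::comm_ring_1 \<Rightarrow> 'a" where
  "ev (a, b, c) x = of_int a + of_int b * x + of_int c * x\<^sup>2"

fun tadd :: "triple \<Rightarrow> triple \<Rightarrow> triple" where
  "tadd (a, b, c) (a', b', c') = (a + a', b + b', c + c')"

fun tscale :: "int \<Rightarrow> triple \<Rightarrow> triple" where
  "tscale k (a, b, c) = (k * a, k * b, k * c)"

text \<open>Multiplication of triples modulo the relation \<open>\<alpha>\<^sup>3 = m\<^sub>0 + m\<^sub>1 \<alpha> + m\<^sub>2 \<alpha>\<^sup>2\<close>.\<close>

fun tmul :: "triple \<Rightarrow> triple \<Rightarrow> triple \<Rightarrow> triple" where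
  "tmul (m0, m1, m2) (a, b, c) (a', b', c') =
     (let d = b * c' + c * b'; e = c * c' in
      (a * a' + m0 * d + m0 * m2 * e,
       a * b' + b * a' + m1 * d + (m0 + m1 * m2) * e,
       a * c' + b * b' + c * a' + m2 * d + (m1 + m2\<^sup>2) * e))"

lemma ev_tadd: "ev (tadd x y) t = ev x t + ev y t"
  by (cases x; cases y) (simp add: algebra_simps)

lemma ev_tscale: "ev (tscale k x) t = of_int k * ev x t"
  by (cases x) (simp add: algebra_simps)

text \<open>Division by t^3 - \<open>ev m t\<close> with an explicit quotient, in any commutative
  ring. It serves twice: as an equation at \<alpha>, and as a congruence at an integer that is a
  root only modulo d.\<close>

lemma ev_tmul:
  obtains q :: "'a::comm_ring_1"
  where "ev x t * ev y t = ev (tmul m x y) t + q * (t ^ 3 - ev m t)"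
proof -
  obtain m0 m1 m2 a b c a' b' c' where "m = (m0, m1, m2)" "x = (a, b, c)" "y = (a', b', c')"
    by (cases m; cases x; cases y)
  then have "ev x t * ev y t = ev (tmul m x y) t
      + (of_int (b * c' + c * b' + c * c' * m2) + of_int (c * c') * t) * (t ^ 3 - ev m t)"
    by (simp add: Let_def algebra_simps power2_eq_square power3_eq_cube)
  then show ?thesis by (rule that)
qed

lemma ev_tmul_root: "t ^ 3 = ev m t \<Longrightarrow> ev (tmul m x y) t = ev x t * ev y t"
  by (rule ev_tmul[of x t y m]) simp

lemma ev_tmul_dvd: "d dvd t ^ 3 - ev m t \<Longrightarrow> d dvd ev x t * ev y t - ev (tmul m x y) (t::int)"
  by (rule ev_tmul[of x t y m]) simp

lemma ev_diff_dvd: "x - y dvd ev g x - ev g (y::int)"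
proof (cases g)
  case (fields a b c)
  have "ev g x - ev g y = (x - y) * (b + c * (x + y))"
    by (simp add: fields algebra_simps power2_eq_square)
  then show ?thesis by simp
qed

lemma cube_diff_dvd: "x - y dvd x ^ 3 - (y::int) ^ 3"
proof -
  have "x ^ 3 - y ^ 3 = (x - y) * (x\<^sup>2 + x * y + y\<^sup>2)"
    by (simp add: algebra_simps power2_eq_square power3_eq_cube)
  then show ?thesis by simp
qed

section \<open>The field generated by a root of an irreducible cubic\<close>

locale cubic_field =
  fixes m :: triple and \<alpha> :: complex
  assumes root: "\<alpha> ^ 3 = ev m \<alpha>" and no_integer_root: "n ^ 3 \<noteq> ev m (n::int)"
begin

lemmas ev_mult = ev_tmul_root[OF root]

definition K :: "complex set" where
  "K = {z. \<exists>x\<in>\<rat>. \<exists>y\<in>\<rat>. \<exists>w\<in>\<rat>. z = x + y * \<alpha> + w * \<alpha>\<^sup>2}"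

text \<open>The cubic is monic over the integers, so a rational root would be an algebraic integer
  and hence an integer.\<close>

lemma no_rational_root:
  assumes "r \<in> \<rat>" shows "r ^ 3 \<noteq> ev m (r::complex)"
proof
  assume r: "r ^ 3 = ev m r"
  obtain m0 m1 m2 where m: "m = (m0, m1, m2)" by (cases m)
  define p :: "complex poly" where "p = [:- of_int m0, - of_int m1, - of_int m2, 1:]"
  have "algebraic_int r"
  proof
    show "lead_coeff p = 1" by (simp add: p_def)
    show "\<forall>i. coeff p i \<in> \<int>" by (auto simp: p_def coeff_pCons split: nat.split)
    show "poly p r = 0" using r by (simp add: p_def m algebra_simps power2_eq_square power3_eq_cube)
  qed
  then have "r \<in> \<int>" using assms by (rule rational_algebraic_int_is_int)
  then obtain n where "r = of_int n" by (auto elim: Ints_cases)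
  then have "(of_int (n ^ 3) :: complex) = of_int (ev m n)" using r by (simp add: m)
  then show False using no_integer_root[of n] by (simp only: of_int_eq_iff)
qed

lemma alpha_irrational: "\<alpha> \<notin> \<rat>"
  using no_rational_root root by blast

lemma independent:
  assumes "x \<in> \<rat>" "y \<in> \<rat>" "w \<in> \<rat>" and zero: "x + y * \<alpha> + w * \<alpha>\<^sup>2 = 0"
  shows "x = 0" "y = 0" "w = 0"
proof -
  obtain m0 m1 m2 where m: "m = (m0, m1, m2)" by (cases m)
  have "w = 0"
  proof (rule ccontr)
    assume w: "w \<noteq> 0"
    define u v where "u = - y / w" and "v = - x / w"
    have uv: "u \<in> \<rat>" "v \<in> \<rat>" using assms by (auto simp: u_def v_def)
    have "w * (\<alpha>\<^sup>2 - (u * \<alpha> + v)) = x + y * \<alpha> + w * \<alpha>\<^sup>2"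
      using w by (simp add: u_def v_def field_simps)
    then have sq: "\<alpha>\<^sup>2 = u * \<alpha> + v" using w zero by simp
    \<comment> \<open>s x - t is the remainder of the cubic on division by x^2 - u x - v. It
      vanishes because \<alpha> is irrational, and the quotient x + u - m2 then yields the rational
      root m2 - u.\<close>
    define s t where "s = u\<^sup>2 + v - m1 - m2 * u" and "t = m0 + m2 * v - u * v"
    have st: "s \<in> \<rat>" "t \<in> \<rat>" using uv by (auto simp: s_def t_def)
    have "\<alpha> ^ 3 = u * \<alpha>\<^sup>2 + v * \<alpha>"
      using arg_cong[OF sq, of "(*) \<alpha>"] by (simp add: power3_eq_cube power2_eq_square algebra_simps)
    then have "\<alpha> ^ 3 = u * (u * \<alpha> + v) + v * \<alpha>" unfolding sq .
    moreover have "\<alpha> ^ 3 = m0 + m1 * \<alpha> + m2 * (u * \<alpha> + v)"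
      using root unfolding m ev.simps sq .
    moreover have "s * \<alpha> - t
      = (u * (u * \<alpha> + v) + v * \<alpha>) - (m0 + m1 * \<alpha> + m2 * (u * \<alpha> + v))"
      by (simp add: s_def t_def algebra_simps power2_eq_square)
    ultimately have "s * \<alpha> = t" by simp
    then have "s = 0" using alpha_irrational st
      by (metis Rats_divide nonzero_mult_div_cancel_left)
    then have "t = 0" using \<open>s * \<alpha> = t\<close> by simp
    have "(m2 - u) ^ 3 - ev m (m2 - u) = (m2 - u) * s - t"
      by (simp add: m s_def t_def algebra_simps power2_eq_square power3_eq_cube)
    then show False using no_rational_root[of "m2 - u"] uv \<open>s = 0\<close> \<open>t = 0\<close> by simp
  qed
  moreover have "y = 0"
  proof (rule ccontr)
    assume y: "y \<noteq> 0"
    then have "\<alpha> = - x / y" using zero \<open>w = 0\<close>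
      by (simp add: field_simps add_eq_0_iff)
    then show False using alpha_irrational assms by auto
  qed
  ultimately show "x = 0" "y = 0" "w = 0" using zero by auto
qed

lemma ev_eq_0_iff [simp]: "ev x \<alpha> = 0 \<longleftrightarrow> x = (0, 0, 0)"
  using independent[of "of_int (fst x)" "of_int (fst (snd x))" "of_int (snd (snd x))"]
  by (cases x) auto

text \<open>This makes equality of coordinates in K decidable by comparing triples.\<close>

lemma ev_inject [simp]: "ev x \<alpha> = ev y \<alpha> \<longleftrightarrow> x = y"
proof -
  have "ev x \<alpha> = ev y \<alpha> \<longleftrightarrow> ev (tadd x (tscale (- 1) y)) \<alpha> = 0"
    by (simp only: ev_tadd ev_tscale) simp
  also have "\<dots> \<longleftrightarrow> x = y" unfolding ev_eq_0_iff by (cases x; cases y) auto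
  finally show ?thesis .
qed

lemma K_intro [intro]: "x \<in> \<rat> \<Longrightarrow> y \<in> \<rat> \<Longrightarrow> w \<in> \<rat> \<Longrightarrow> x + y * \<alpha> + w * \<alpha>\<^sup>2 \<in> K"
  by (auto simp: K_def)

lemma Rats_subset_K: "x \<in> \<rat> \<Longrightarrow> x \<in> K"
  using K_intro[of x 0 0] by simp

lemma ev_in_K [simp, intro]: "ev x \<alpha> \<in> K"
  by (cases x) auto

lemma add_in_K: "x \<in> K \<Longrightarrow> y \<in> K \<Longrightarrow> x + y \<in> K"
  unfolding K_def
proof clarify
  fix a b c d e f :: complex assume "a \<in> \<rat>" "b \<in> \<rat>" "c \<in> \<rat>" "d \<in> \<rat>" "e \<in> \<rat>" "f \<in> \<rat>"
  then show "\<exists>x\<in>\<rat>. \<exists>y\<in>\<rat>. \<exists>w\<in>\<rat>.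
      a + b * \<alpha> + c * \<alpha>\<^sup>2 + (d + e * \<alpha> + f * \<alpha>\<^sup>2) = x + y * \<alpha> + w * \<alpha>\<^sup>2"
    by (intro bexI[of _ "a + d"] bexI[of _ "b + e"] bexI[of _ "c + f"])
      (auto simp: algebra_simps)
qed

lemma common_denominator:
  assumes "z \<in> K" obtains n g where "n \<noteq> 0" and "of_int n * z = ev g \<alpha>"
proof -
  obtain x y w where z: "x \<in> \<rat>" "y \<in> \<rat>" "w \<in> \<rat>" "z = x + y * \<alpha> + w * \<alpha>\<^sup>2"
    using assms by (auto simp: K_def)
  have *: "\<exists>p q. q \<noteq> 0 \<and> u = of_int p / of_int q" if "u \<in> \<rat>" for u :: complex
    using that by (metis Rats_cases' less_numeral_extra(3))
  obtain p q p' q' p'' q'' where q: "q \<noteq> 0" "q' \<noteq> 0" "q'' \<noteq> 0"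
    and pq: "x = of_int p / of_int q" "y = of_int p' / of_int q'" "w = of_int p'' / of_int q''"
    using *[OF z(1)] *[OF z(2)] *[OF z(3)] by blast
  show thesis
  proof (rule that)
    show "q * q' * q'' \<noteq> 0" using q by simp
    show "of_int (q * q' * q'') * z = ev (p * q' * q'', q * p' * q'', q * q' * p'') \<alpha>"
      using q by (simp add: z(4) pq field_simps)
  qed
qed

lemma of_denominator:
  assumes "n \<noteq> 0" "of_int n * z = ev g \<alpha>" shows "z \<in> K"
proof (cases g)
  case (fields a b c)
  have "z = of_int a / of_int n + of_int b / of_int n * \<alpha> + of_int c / of_int n * \<alpha>\<^sup>2"
    using assms fields by (simp add: field_simps)
  then show ?thesis by (simp only:) (intro K_intro Rats_divide Rats_of_int)
qed

lemma mult_in_K: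
  assumes "x \<in> K" "y \<in> K" shows "x * y \<in> K"
proof -
  obtain n g n' g' where "n \<noteq> 0" "of_int n * x = ev g \<alpha>" "n' \<noteq> 0" "of_int n' * y = ev g' \<alpha>"
    using assms by (metis common_denominator)
  then have "of_int (n * n') * (x * y) = ev (tmul m g g') \<alpha>" "n * n' \<noteq> 0"
    by (simp_all add: ev_mult flip: mult.assoc) (metis mult.assoc mult.commute)
  then show ?thesis using of_denominator by blast
qed

lemma minus_in_K: "x \<in> K \<Longrightarrow> - x \<in> K"
  using mult_in_K[of "- 1" x] Rats_subset_K[of "- 1"] by simp

lemma diff_in_K: "x \<in> K \<Longrightarrow> y \<in> K \<Longrightarrow> x - y \<in> K"
  using add_in_K[of x "- y"] minus_in_K by simp

text \<open>Cayley--Hamilton for multiplication by \<open>z\<close>.\<close>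

lemma cubic_equation:
  assumes "z \<in> K"
  obtains s t u where "s \<in> \<rat>" "t \<in> \<rat>" "u \<in> \<rat>" "z ^ 3 = s * z\<^sup>2 + t * z + u"
proof -
  obtain a b c where z: "a \<in> \<rat>" "b \<in> \<rat>" "c \<in> \<rat>" "z = a + b * \<alpha> + c * \<alpha>\<^sup>2"
    using assms by (auto simp: K_def)
  obtain n0 n1 n2 where m: "m = (n0, n1, n2)" by (cases m)
  define m0 m1 m2 :: complex where "m0 = of_int n0" and "m1 = of_int n1" and "m2 = of_int n2"
  have mQ: "m0 \<in> \<rat>" "m1 \<in> \<rat>" "m2 \<in> \<rat>" by (auto simp: m0_def m1_def m2_def)
  \<comment> \<open>s, t and u are the trace, the second symmetric function and the norm of z. The
    cofactor below is the quotient on division by the relation for \<alpha>.\<close>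
  define s where "s = c * m2^2 + 2 * c * m1 + b * m2 + 3 * a"
  define t where "t = c^2 * m1^2 - 2 * c^2 * m0 * m2 - b * c * m1 * m2 - 3 * b * c * m0 - b^2 * m1
    + 2 * a * c * m2^2 + 4 * a * c * m1 + 2 * a * b * m2 + 3 * a^2"
  define u where "u = c^3 * m0^2 - b * c^2 * m0 * m1 + b^2 * c * m0 * m2 + b^3 * m0 + a * c^2 * m1^2
    - 2 * a * c^2 * m0 * m2 - a * b * c * m1 * m2 - 3 * a * b * c * m0 - a * b^2 * m1
    + a^2 * c * m2^2 + 2 * a^2 * c * m1 + a^2 * b * m2 + a^3"
  have "z ^ 3 - s * z\<^sup>2 + t * z - u = (\<alpha> ^ 3 - (m0 + m1 * \<alpha> + m2 * \<alpha>\<^sup>2)) *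
    ((c^3 * m0 - b * c^2 * m1 + b^2 * c * m2 + b^3) + (2 * b * c^2 * m2 + 3 * b^2 * c - c^3 * m1) * \<alpha>
      + (c^3 * m2 + 3 * b * c^2) * \<alpha>\<^sup>2 + c^3 * \<alpha>^3)"
    unfolding z(4) s_def t_def u_def
    by (simp add: algebra_simps power2_eq_square power3_eq_cube)
  also have "\<dots> = 0" using root by (simp add: m m0_def m1_def m2_def)
  finally have "z ^ 3 = s * z\<^sup>2 + (- t) * z + u" by (simp add: algebra_simps)
  moreover have "s \<in> \<rat>" "- t \<in> \<rat>" "u \<in> \<rat>"
    using z mQ by (auto simp: s_def t_def u_def intro!: Rats_add Rats_diff Rats_mult Rats_power)
  ultimately show thesis using that by blast
qed

text \<open>After cancelling the power of z that divides the cubic equation, the inverse can be read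
  off from the lowest nonzero coefficient.\<close>

lemma inverse_in_K:
  assumes "z \<in> K" shows "inverse z \<in> K"
proof (cases "z = 0")
  case False
  obtain s t u where stu: "s \<in> \<rat>" "t \<in> \<rat>" "u \<in> \<rat>" and eq: "z ^ 3 = s * z\<^sup>2 + t * z + u"
    using cubic_equation[OF assms] .
  have sq: "z\<^sup>2 \<in> K" using assms by (simp add: power2_eq_square mult_in_K)
  consider "u \<noteq> 0" | "u = 0" "t \<noteq> 0" | "u = 0" "t = 0" by blast
  then show ?thesis
  proof cases
    case 1
    have "z * (z\<^sup>2 - s * z - t) = u" using eq by (simp add: algebra_simps power2_eq_square power3_eq_cube)
    then have "z * ((z\<^sup>2 - s * z - t) * inverse u) = 1" using 1 by (simp flip: mult.assoc)
    then have "inverse z = (z\<^sup>2 - s * z - t) * inverse u" by (rule inverse_unique)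
    then show ?thesis using assms sq stu by (simp add: mult_in_K diff_in_K Rats_subset_K)
  next
    case 2
    have "z * (z * (z - s) - t) = 0" using eq 2 by (simp add: algebra_simps power2_eq_square power3_eq_cube)
    then have "z * (z - s) = t" using False by simp
    then have "z * ((z - s) * inverse t) = 1" using 2 by (simp flip: mult.assoc)
    then have "inverse z = (z - s) * inverse t" by (rule inverse_unique)
    then show ?thesis using assms stu by (simp add: mult_in_K diff_in_K Rats_subset_K)
  next
    case 3
    have "z * (z * (z - s)) = 0" using eq 3 by (simp add: algebra_simps power2_eq_square power3_eq_cube)
    then have "z = s" using False by simp
    then show ?thesis using stu by (auto intro!: Rats_subset_K)
  qed
qed (simp add: Rats_subset_K)

lemma divide_in_K: "x \<in> K \<Longrightarrow> y \<in> K \<Longrightarrow> x / y \<in> K"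
  by (simp add: divide_inverse mult_in_K inverse_in_K)

lemma numeral_in_K [simp]: "0 \<in> K" "1 \<in> K" "numeral n \<in> K"
  by (auto intro: Rats_subset_K)

lemma power_in_K: "x \<in> K \<Longrightarrow> x ^ n \<in> K"
  by (induction n) (auto simp: mult_in_K)

lemmas K_closed = add_in_K diff_in_K minus_in_K mult_in_K divide_in_K power_in_K

lemma cubic_number_field_K: "cubic_number_field K"
proof -
  let ?C = "ring_of_type_algebra :: complex ring"
  interpret C: field ?C by (rule field_from_type_algebra)
  have simps [simp]: "carrier ?C = UNIV" "x \<otimes>\<^bsub>?C\<^esub> y = x * y" "x \<oplus>\<^bsub>?C\<^esub> y = x + y"
    "\<zero>\<^bsub>?C\<^esub> = 0" "\<one>\<^bsub>?C\<^esub> = 1" for x y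
    by (simp_all add: ring_of_type_algebra_def)
  have neg: "\<ominus>\<^bsub>?C\<^esub> x = - x" for x
    using C.minus_equality[of "- x" x] by simp
  have "inv\<^bsub>?C\<^esub> x = inverse x" if "x \<noteq> 0" for x
    using C.comm_inv_char[of x "inverse x"] that by simp
  then have "subfield K ?C"
    by (intro C.subfieldI' C.subringI) (auto simp: neg K_closed inverse_in_K)
  moreover have "C.dimension 3 \<rat> K"
  proof -
    \<comment> \<open>The dimension is witnessed by the flag from {0} through the multiples of
      \<alpha>^2 and the span of \<alpha> and \<alpha>^2 to K, each space extended by one vector
      outside it.\<close>
    have line: "C.line_extension \<rat> v S = {z. \<exists>x\<in>\<rat>. \<exists>s\<in>S. z = x * v + s}" for v S
      by (simp add: set_eq_iff C.line_extension_mem_iff)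
    define S1 where "S1 = C.line_extension \<rat> (\<alpha>\<^sup>2) {0}"
    define S2 where "S2 = C.line_extension \<rat> \<alpha> S1"
    have S1: "S1 = {z. \<exists>w\<in>\<rat>. z = w * \<alpha>\<^sup>2}" by (simp add: S1_def line)
    have S2: "S2 = {z. \<exists>y\<in>\<rat>. \<exists>w\<in>\<rat>. z = y * \<alpha> + w * \<alpha>\<^sup>2}"
      unfolding S2_def line S1 by blast
    have "K = C.line_extension \<rat> 1 S2"
      unfolding K_def line S2 mult_1_right add.assoc by blast
    moreover have "\<alpha>\<^sup>2 \<notin> {0}" using independent(3)[of 0 0 1] by auto
    moreover have "\<alpha> \<notin> S1"
    proof
      assume "\<alpha> \<in> S1"
      then obtain w where "w \<in> \<rat>" "\<alpha> = w * \<alpha>\<^sup>2" by (auto simp: S1)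
      then show False using independent(2)[of 0 1 "- w"] by simp
    qed
    moreover have "1 \<notin> S2"
    proof
      assume "1 \<in> S2"
      then obtain y w where "y \<in> \<rat>" "w \<in> \<rat>" "1 = y * \<alpha> + w * \<alpha>\<^sup>2" by (auto simp: S2)
      moreover from this have "1 + - y * \<alpha> + - w * \<alpha>\<^sup>2 = 0" by (simp add: algebra_simps)
      ultimately show False using independent(1)[of 1 "- y" "- w"] by simp
    qed
    moreover have "C.dimension 0 \<rat> {0}" using C.zero_dim[of \<rat>] by simp
    ultimately show ?thesis
      unfolding S2_def S1_def numeral_3_eq_3 by (simp add: C.Suc_dim)
  qed
  ultimately show ?thesis unfolding cubic_number_field_def by blast
qed

end

text \<open>Having no root modulo q is a finite certificate for having no integer root, and thus for
  irreducibility.\<close>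

lemma exists_cubic_field:
  fixes q :: int
  assumes "q > 0" and "\<forall>n\<in>{0..<q}. \<not> q dvd n ^ 3 - ev m n"
  obtains \<alpha> where "cubic_field m \<alpha>"
proof -
  obtain m0 m1 m2 where m: "m = (m0, m1, m2)" by (cases m)
  define p :: "complex poly" where "p = [:- of_int m0, - of_int m1, - of_int m2, 1:]"
  have "\<not> constant (poly p)" by (simp add: constant_degree p_def)
  then obtain \<alpha> where "poly p \<alpha> = 0" using fundamental_theorem_of_algebra by blast
  then have "\<alpha> ^ 3 = ev m \<alpha>" by (simp add: p_def m algebra_simps power2_eq_square power3_eq_cube)
  moreover have "n ^ 3 \<noteq> ev m n" for n :: int
  proof
    assume n: "n ^ 3 = ev m n"
    have dq: "q dvd n mod q - n" by (metis dvd_minus_mod dvd_diff_commute)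
    have "q dvd (n mod q) ^ 3 - n ^ 3 - (ev m (n mod q) - ev m n)"
      by (intro dvd_diff dvd_trans[OF dq cube_diff_dvd] dvd_trans[OF dq ev_diff_dvd])
    then have "q dvd (n mod q) ^ 3 - ev m (n mod q)" using n by simp
    then show False using assms by auto
  qed
  ultimately show thesis by (intro that) (simp add: cubic_field_def)
qed

section \<open>Polynomials without roots in a cubic field\<close>

text \<open>
  The monic polynomial whose lower coefficients, starting with the constant one, are the given list,
  evaluated at \<open>x / n\<close> and cleared of denominators.
\<close>

fun hpoly :: "'a::comm_ring_1 \<Rightarrow> 'a \<Rightarrow> 'a list \<Rightarrow> 'a" where
  "hpoly x n [] = 1"
| "hpoly x n (e # es) = e * n ^ Suc (length es) + x * hpoly x n es"

text \<open>The value of \<open>hpoly\<close> at an element g of Z[\<alpha>], kept as a triple. If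
  it vanishes at \<alpha>, the triple is zero; then it also vanishes at an integer R, which gives a
  congruence whenever R is a root of the cubic modulo d. This carries equations from K to the
  integers.\<close>

fun tpoly :: "triple \<Rightarrow> triple \<Rightarrow> int \<Rightarrow> triple list \<Rightarrow> triple" where
  "tpoly m g n [] = (1, 0, 0)"
| "tpoly m g n (c # cs) = tadd (tscale (n ^ Suc (length cs)) c) (tmul m g (tpoly m g n cs))"

lemma hpoly_scale: "hpoly (t * x) (t * n) es = t ^ length es * hpoly x n es"
  by (induction es) (simp_all add: algebra_simps power_mult_distrib)

lemma dvd_mult_diff:
  fixes d :: int assumes "d dvd x - x'" "d dvd y - y'" shows "d dvd x * y - x' * y'"
proof -
  have "x * y - x' * y' = (x - x') * y + x' * (y - y')" by (simp add: algebra_simps)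
  then show ?thesis using assms by simp
qed

lemma dvd_add_diff:
  fixes d :: int assumes "d dvd x - x'" "d dvd y - y'" shows "d dvd x + y - (x' + y')"
proof -
  have "x + y - (x' + y') = (x - x') + (y - y')" by simp
  then show ?thesis using assms by (simp only: dvd_add)
qed

lemma dvd_power_diff:
  fixes d :: int assumes "d dvd x - x'" shows "d dvd x ^ k - x' ^ k"
  by (induction k) (auto intro: dvd_mult_diff assms)

lemma hpoly_dvd_diff:
  fixes d :: int
  assumes "d dvd x - x'" "d dvd n - n'" "list_all2 (\<lambda>e e'. d dvd e - e') es es'"
  shows "d dvd hpoly x n es - hpoly x' n' es'"
  using assms(3)
proof (induction rule: list_all2_induct)
  case (Cons e es e' es')
  have "length es = length es'" using Cons.hyps(2) by (rule list_all2_lengthD)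
  then show ?case using Cons assms(1,2)
    by (auto intro!: dvd_add_diff dvd_mult_diff dvd_power_diff simp del: power_Suc)
qed simp

section \<open>Cancelling denominators and lifting roots modulo powers of p\<close>

lemma prime_inverse:
  fixes p n :: int
  assumes "Factorial_Ring.prime p" "\<not> p dvd n" obtains u where "p dvd n * u - 1"
proof -
  have "coprime n p" using assms prime_imp_coprime coprime_commute by blast
  then obtain u v where "u * n + v * p = 1" using bezout_int[of n p] by auto
  then have "n * u - 1 = p * (- v)" by (simp add: algebra_simps)
  then show thesis using that by (metis dvd_triv_left)
qed

text \<open>A finite-precision form of the fact that roots of monic polynomials are integral at p.
  If p divides n, the leading term forces p to divide x as well; cancelling p from both costs p to
  the power of the degree, by homogeneity. Once n is invertible modulo p, the quotient x / n reduces
  to a root.\<close>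

lemma hpoly_root_modulo_prime:
  fixes p :: int
  assumes p: "Factorial_Ring.prime p"
  assumes "\<not> p ^ Suc k dvd n" "p ^ (k * length es + 1) dvd hpoly x n es"
  shows "\<exists>w\<in>{0..<p}. p dvd hpoly w 1 es"
  using assms(2,3)
proof (induction k arbitrary: x n)
  have unit: "\<exists>w\<in>{0..<p}. p dvd hpoly w 1 es" if n: "\<not> p dvd n" and dvd: "p dvd hpoly x n es" for x n
  proof -
    obtain u where u: "p dvd n * u - 1" using prime_inverse[OF p n] .
    have "p dvd hpoly (u * x) (u * n) es" using dvd by (simp add: hpoly_scale)
    moreover have "p dvd hpoly ((u * x) mod p) 1 es - hpoly (u * x) (u * n) es"
    proof (rule hpoly_dvd_diff)
      show "p dvd u * x mod p - u * x" by (metis dvd_minus_mod dvd_diff_commute)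
      show "p dvd 1 - u * n" using u by (metis dvd_diff_commute mult.commute)
    qed (simp add: list_all2_refl)
    ultimately have "p dvd hpoly ((u * x) mod p) 1 es" using dvd_diffD by (metis dvd_diff_right_iff dvd_diff_commute)
    moreover have "(u * x) mod p \<in> {0..<p}" using prime_gt_0_int[OF p] by simp
    ultimately show ?thesis by blast
  qed
  {
    case 0
    then show ?case using unit by simp
  next
    case (Suc k)
    have len: "p dvd hpoly x n es" using Suc.prems(2) by (metis dvd_trans dvd_triv_right power_add power_one_right)
    show ?case
    proof (cases "p dvd n")
      case False then show ?thesis using unit len by blast
    next
      case True
      have "p dvd hpoly x n es' \<Longrightarrow> p dvd x \<and> es' \<noteq> []" for es'
      proof (induction es')
        case Nil then show ?case using p by auto
      next
        case (Cons e es')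
        then have "p dvd x * hpoly x n es'" using True by (simp add: dvd_add_right_iff)
        then show ?case using Cons.IH p by (auto simp: prime_dvd_mult_iff)
      qed
      then have "p dvd x" using len by blast
      with True obtain x' n' where x': "x = p * x'" and n': "n = p * n'" by (metis dvdE)
      have "p \<noteq> 0" using p by auto
      have "p ^ length es * p ^ (k * length es + 1) dvd p ^ length es * hpoly x' n' es"
        using Suc.prems(2) unfolding x' n' hpoly_scale by (simp add: power_add algebra_simps)
      then have "p ^ (k * length es + 1) dvd hpoly x' n' es" using \<open>p \<noteq> 0\<close> by (simp only: dvd_mult_cancel_left) simp
      moreover have "\<not> p ^ Suc k dvd n'" using Suc.prems(1) \<open>p \<noteq> 0\<close> by (simp add: n')
      ultimately show ?thesis using Suc.IH by blast
    qed
  }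
qed

fun ev_deriv :: "triple \<Rightarrow> int \<Rightarrow> int" where
  "ev_deriv (a, b, c) x = b + 2 * c * x"

text \<open>Newton's step with the derivative inverted only modulo p gains one power of p at a time.
  The derivative stays invertible because R stays congruent to r.\<close>

lemma hensel:
  fixes p :: int
  assumes p: "Factorial_Ring.prime p" and root: "p dvd r ^ 3 - ev m r"
    and simple: "\<not> p dvd 3 * r\<^sup>2 - ev_deriv m r"
  obtains R where "p dvd R - r" "p ^ Suc k dvd R ^ 3 - ev m R"
proof -
  have "\<exists>R. p dvd R - r \<and> p ^ Suc k dvd R ^ 3 - ev m R"
  proof (induction k)
    case 0 show ?case using root by (auto intro!: exI[of _ r])
  next
    case (Suc k)
    then obtain R where R: "p dvd R - r" "p ^ Suc k dvd R ^ 3 - ev m R" by blast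
    obtain a b c where m: "m = (a, b, c)" by (cases m)
    define D where "D = 3 * R\<^sup>2 - ev_deriv m R"
    have "D - (3 * r\<^sup>2 - ev_deriv m r) = (R - r) * (3 * (R + r) - 2 * c)"
      by (simp add: D_def m algebra_simps power2_eq_square)
    then have "\<not> p dvd D" using R(1) simple by (metis dvd_diff_right_iff dvd_mult2)
    then obtain u where u: "p dvd D * u - 1" using prime_inverse[OF p] by blast
    obtain q where q: "R ^ 3 - ev m R = p ^ Suc k * q" using R(2) by (auto elim: dvdE)
    define h where "h = - (p ^ Suc k * (u * q))"
    have "(R + h) ^ 3 - ev m (R + h) = (R ^ 3 - ev m R) + h * D + h\<^sup>2 * (3 * R + h - c)"
      by (simp add: D_def m algebra_simps power2_eq_square power3_eq_cube)
    also have "\<dots> = - (p ^ Suc k * (q * (D * u - 1))) + h\<^sup>2 * (3 * R + h - c)"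
      unfolding q h_def by (simp add: algebra_simps)
    also have "p ^ Suc (Suc k) dvd \<dots>"
    proof (rule dvd_add)
      show "p ^ Suc (Suc k) dvd - (p ^ Suc k * (q * (D * u - 1)))"
        using u by (simp add: mult_dvd_mono mult.commute[of p])
      have "p ^ Suc (Suc k) dvd p ^ (Suc k + Suc k)" by (rule le_imp_power_dvd) simp
      also have "\<dots> dvd h\<^sup>2" by (simp add: h_def power_add power_mult_distrib power2_eq_square algebra_simps)
      finally show "p ^ Suc (Suc k) dvd h\<^sup>2 * (3 * R + h - c)" by simp
    qed
    finally have "p ^ Suc (Suc k) dvd (R + h) ^ 3 - ev m (R + h)" .
    moreover have "p dvd R + h - r"
    proof -
      have "R + h - r = (R - r) + h" by simp
      moreover have "p dvd h" by (simp add: h_def)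
      ultimately show ?thesis using R(1) by (simp only: dvd_add)
    qed
    ultimately show ?case by blast
  qed
  then show thesis using that by blast
qed

lemma tpoly_dvd:
  fixes d :: int assumes "d dvd R ^ 3 - ev m R"
  shows "d dvd hpoly (ev g R) n (map (\<lambda>c. ev c R) cs) - ev (tpoly m g n cs) R"
proof (induction cs)
  case (Cons c cs)
  let ?h = "hpoly (ev g R) n (map (\<lambda>c. ev c R) cs)" and ?t = "tpoly m g n cs"
  have "hpoly (ev g R) n (map (\<lambda>c. ev c R) (c # cs)) - ev (tpoly m g n (c # cs)) R
    = (ev g R * ev ?t R - ev (tmul m g ?t) R) + ev g R * (?h - ev ?t R)"
    by (simp add: ev_tadd ev_tscale algebra_simps del: ev.simps)
  then show ?case using ev_tmul_dvd[OF assms, of g ?t] Cons by (simp only: dvd_add dvd_mult)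
qed simp

section \<open>A criterion for a polynomial to have no root in K\<close>

definition no_root_int :: "int \<Rightarrow> int list \<Rightarrow> bool" where
  "no_root_int p es \<longleftrightarrow> list_all (\<lambda>w. \<not> p dvd hpoly w 1 es) [0..p - 1]"

text \<open>The simple root r modulo p stands for the embedding of K into the p-adic numbers that
  sends \<alpha> to the lift of r. Reducing the coefficients modulo p keeps the numbers small in the
  search over residues.\<close>

definition no_root_mod :: "triple \<Rightarrow> int \<Rightarrow> int \<Rightarrow> triple list \<Rightarrow> bool" where
  "no_root_mod m p r cs \<longleftrightarrow> Factorial_Ring.prime p \<and> p dvd r ^ 3 - ev m r \<and>
     \<not> p dvd 3 * r\<^sup>2 - ev_deriv m r \<and>
     no_root_int p (map (\<lambda>c. ev c r mod p) cs)"

context cubic_field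
begin

lemma ev_tpoly:
  "ev (tpoly m g n cs) \<alpha> = hpoly (ev g \<alpha>) (of_int n) (map (\<lambda>c. ev c \<alpha>) cs)"
  by (induction cs) (simp_all add: ev_tadd ev_tscale ev_mult del: ev.simps, simp_all)

text \<open>For z = g / n with g in Z[\<alpha>], the equation cleared of denominators is an identity
  of triples. Evaluated at an integer R close to the p-adic image of \<alpha>, it yields a root
  modulo p.\<close>

lemma no_root:
  assumes "no_root_mod m p r cs" and z: "z \<in> K"
  shows "hpoly z 1 (map (\<lambda>c. ev c \<alpha>) cs) \<noteq> 0"
proof
  assume 0: "hpoly z 1 (map (\<lambda>c. ev c \<alpha>) cs) = 0"
  have p: "Factorial_Ring.prime p" and pr: "p dvd r ^ 3 - ev m r" "\<not> p dvd 3 * r\<^sup>2 - ev_deriv m r"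
    and none: "\<And>w. w \<in> {0..<p} \<Longrightarrow> \<not> p dvd hpoly w 1 (map (\<lambda>c. ev c r mod p) cs)"
    using assms(1) by (auto simp: no_root_mod_def no_root_int_def list_all_iff)
  obtain n g where n: "n \<noteq> 0" and g: "of_int n * z = ev g \<alpha>" using common_denominator[OF z] .
  have "ev (tpoly m g n cs) \<alpha> = 0"
    using 0 hpoly_scale[of "of_int n" z 1 "map (\<lambda>c. ev c \<alpha>) cs"] by (simp add: ev_tpoly flip: g)
  then have t0: "tpoly m g n cs = (0, 0, 0)" by simp
  define k where "k = multiplicity p n"
  have "\<not> p ^ Suc k dvd n"
    using n p by (metis k_def multiplicity_dvd' not_prime_unit not_less_eq_eq order_refl power_dvd_iff_le_multiplicity prime_elem_def prime_imp_prime_elem)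
  \<comment> \<open>If p^k is the power of p in n, cancelling it uses up at most k *
    \<open>length cs\<close> powers of p; one more is needed for the congruence that
    remains.\<close>
  moreover obtain R where R: "p dvd R - r" "p ^ Suc (k * length cs) dvd R ^ 3 - ev m R"
    using hensel[OF p pr] .
  have "p ^ (k * length (map (\<lambda>c. ev c R) cs) + 1) dvd hpoly (ev g R) n (map (\<lambda>c. ev c R) cs)"
    using tpoly_dvd[OF R(2), of g n cs] t0 by simp
  ultimately obtain w where w: "w \<in> {0..<p}" "p dvd hpoly w 1 (map (\<lambda>c. ev c R) cs)"
    using hpoly_root_modulo_prime[OF p] by blast
  have "p dvd ev c R - ev c r mod p" for c
  proof -
    have "ev c R - ev c r mod p = (ev c R - ev c r) + (ev c r - ev c r mod p)" by simp
    moreover have "p dvd ev c R - ev c r" using R(1) ev_diff_dvd by (rule dvd_trans)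
    ultimately show ?thesis by (simp only: dvd_add dvd_minus_mod)
  qed
  then have "p dvd hpoly w 1 (map (\<lambda>c. ev c R) cs) - hpoly w 1 (map (\<lambda>c. ev c r mod p) cs)"
    by (intro hpoly_dvd_diff) (auto simp: list_all2_map1 list_all2_map2 intro!: list_all2_refl)
  then have "p dvd hpoly w 1 (map (\<lambda>c. ev c r mod p) cs)" using w(2) by (metis dvd_diff_right_iff)
  then show False using none w(1) by blast
qed

end

section \<open>Embedding finitely generated groups\<close>

context comm_group
begin

lemma has_subgroup_of_injective_hom:
  assumes A: "group A" and h: "h \<in> hom A G"
    and ker: "\<And>a. a \<in> carrier A \<Longrightarrow> h a = \<one> \<Longrightarrow> a = \<one>\<^bsub>A\<^esub>"
  shows "has_subgroup_isomorphic_to G A"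
proof -
  interpret hom: group_hom A G h
    using A h by (simp add: group_hom_def group_hom_axioms_def is_group)
  have inj: "inj_on h (carrier A)" using ker by (simp add: hom.inj_on_one_iff)
  have "h \<in> iso A (G\<lparr>carrier := h ` carrier A\<rparr>)"
    using inj h by (auto simp: iso_def hom_def bij_betw_def)
  then have "A \<cong> G\<lparr>carrier := h ` carrier A\<rparr>" by (rule is_isoI)
  then have "G\<lparr>carrier := h ` carrier A\<rparr> \<cong> A" by (rule group.iso_sym[OF A])
  then show ?thesis
    unfolding has_subgroup_isomorphic_to_def using hom.img_is_subgroup by blast
qed

lemma hom_int_pow:
  assumes "x \<in> carrier G" shows "(\<lambda>k::int. x [^] k) \<in> hom integer_group G"
  using assms by (auto simp: hom_def int_pow_mult)

lemma hom_int_pow_mod: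
  assumes x: "x \<in> carrier G" and n: "n > 0" "x [^] n = \<one>"
  shows "(\<lambda>k::int. x [^] k) \<in> hom (integer_mod_group n) G"
proof -
  have "x [^] (k mod int n) = x [^] k" for k :: int
  proof -
    have "x [^] k = x [^] (int n * (k div int n) + k mod int n)" by simp
    also have "\<dots> = (x [^] int n) [^] (k div int n) \<otimes> x [^] (k mod int n)"
      using x by (simp only: int_pow_mult int_pow_pow)
    also have "x [^] int n = \<one>" using n by (simp add: int_pow_int)
    finally show ?thesis using x by simp
  qed
  then show ?thesis using x by (auto simp: hom_def int_pow_mult)
qed

lemma hom_DirProd_mult:
  assumes g: "g \<in> hom A G" and h: "h \<in> hom B G"
  shows "(\<lambda>(a, b). g a \<otimes> h b) \<in> hom (A \<times>\<times> B) G"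
proof (rule homI)
  fix x assume "x \<in> carrier (A \<times>\<times> B)"
  then show "(case x of (a, b) \<Rightarrow> g a \<otimes> h b) \<in> carrier G"
    using hom_in_carrier[OF g] hom_in_carrier[OF h] by auto
next
  fix x y assume "x \<in> carrier (A \<times>\<times> B)" "y \<in> carrier (A \<times>\<times> B)"
  then obtain a b a' b' where "x = (a, b)" "y = (a', b')"
    "a \<in> carrier A" "b \<in> carrier B" "a' \<in> carrier A" "b' \<in> carrier B" by auto
  then show "(case x \<otimes>\<^bsub>A \<times>\<times> B\<^esub> y of (a, b) \<Rightarrow> g a \<otimes> h b)
      = (case x of (a, b) \<Rightarrow> g a \<otimes> h b) \<otimes> (case y of (a, b) \<Rightarrow> g a \<otimes> h b)"
    using hom_in_carrier[OF g] hom_in_carrier[OF h] by (simp add: hom_mult[OF g] hom_mult[OF h] m_ac)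
qed

lemma integer_mod_group_eq_0:
  "k \<in> carrier (integer_mod_group n) \<Longrightarrow> n > 0 \<Longrightarrow> int n dvd k \<Longrightarrow> k = 0"
  by (auto simp: carrier_integer_mod_group zdvd_not_zless dest: zdvd_imp_le split: if_splits)

section \<open>Embeddings given by generators without further relations\<close>

lemma embed_mod_int:
  assumes "n > 0" "t \<in> carrier G" "p \<in> carrier G" "t [^] n = \<one>"
    and indep: "\<And>(i::int) (j::int). t [^] i \<otimes> p [^] j = \<one> \<Longrightarrow> int n dvd i \<and> j = 0"
  shows "has_subgroup_isomorphic_to G (integer_mod_group n \<times>\<times> integer_group)"
proof (rule has_subgroup_of_injective_hom)
  show "(\<lambda>(i, j). t [^] i \<otimes> p [^] j) \<in> hom (integer_mod_group n \<times>\<times> integer_group) G"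
    using assms by (intro hom_DirProd_mult hom_int_pow hom_int_pow_mod)
next
  fix x
  assume x: "x \<in> carrier (integer_mod_group n \<times>\<times> integer_group)"
    and "(case x of (i, j) \<Rightarrow> t [^] i \<otimes> p [^] j) = \<one>"
  moreover obtain i j where "x = (i, j)" by (cases x)
  ultimately show "x = \<one>\<^bsub>integer_mod_group n \<times>\<times> integer_group\<^esub>"
    using indep[of i j] integer_mod_group_eq_0[of i n] assms(1) by simp
qed (simp add: DirProd_group)

lemma embed_mod_int_int:
  assumes "n > 0" "t \<in> carrier G" "p \<in> carrier G" "q \<in> carrier G" "t [^] n = \<one>"
    and indep: "\<And>(i::int) (j::int) (k::int). t [^] i \<otimes> (p [^] j \<otimes> q [^] k) = \<one> \<Longrightarrow> int n dvd i \<and> j = 0 \<and> k = 0"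
  shows "has_subgroup_isomorphic_to G (integer_mod_group n \<times>\<times> integer_group \<times>\<times> integer_group)"
proof (rule has_subgroup_of_injective_hom)
  show "(\<lambda>(i, y). t [^] i \<otimes> (case y of (j, k) \<Rightarrow> p [^] j \<otimes> q [^] k))
      \<in> hom (integer_mod_group n \<times>\<times> integer_group \<times>\<times> integer_group) G"
    using assms by (intro hom_DirProd_mult hom_int_pow hom_int_pow_mod)
next
  fix x
  assume x: "x \<in> carrier (integer_mod_group n \<times>\<times> integer_group \<times>\<times> integer_group)"
    and "(case x of (i, y) \<Rightarrow> t [^] i \<otimes> (case y of (j, k) \<Rightarrow> p [^] j \<otimes> q [^] k)) = \<one>"
  moreover obtain i j k where "x = (i, j, k)" by (cases x)
  ultimately show "x = \<one>\<^bsub>integer_mod_group n \<times>\<times> integer_group \<times>\<times> integer_group\<^esub>"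
    using indep[of i j k] integer_mod_group_eq_0[of i n] assms(1) by simp
qed (simp add: DirProd_group)

lemma embed_mod_mod_int:
  assumes "l > 0" "n > 0" "s \<in> carrier G" "t \<in> carrier G" "p \<in> carrier G"
    "s [^] l = \<one>" "t [^] n = \<one>"
    and indep: "\<And>(i::int) (j::int) (k::int). s [^] i \<otimes> (t [^] j \<otimes> p [^] k) = \<one>
      \<Longrightarrow> int l dvd i \<and> int n dvd j \<and> k = 0"
  shows "has_subgroup_isomorphic_to G
    (integer_mod_group l \<times>\<times> integer_mod_group n \<times>\<times> integer_group)"
proof (rule has_subgroup_of_injective_hom)
  show "(\<lambda>(i, y). s [^] i \<otimes> (case y of (j, k) \<Rightarrow> t [^] j \<otimes> p [^] k))
      \<in> hom (integer_mod_group l \<times>\<times> integer_mod_group n \<times>\<times> integer_group) G"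
    using assms by (intro hom_DirProd_mult hom_int_pow hom_int_pow_mod)
next
  fix x
  assume x: "x \<in> carrier (integer_mod_group l \<times>\<times> integer_mod_group n \<times>\<times> integer_group)"
    and "(case x of (i, y) \<Rightarrow> s [^] i \<otimes> (case y of (j, k) \<Rightarrow> t [^] j \<otimes> p [^] k)) = \<one>"
  moreover obtain i j k where "x = (i, j, k)" by (cases x)
  ultimately show "x = \<one>\<^bsub>integer_mod_group l \<times>\<times> integer_mod_group n \<times>\<times> integer_group\<^esub>"
    using indep[of i j k] integer_mod_group_eq_0[of i l] integer_mod_group_eq_0[of j n] assms(1,2)
    by simp
qed (simp add: DirProd_group)

section \<open>Independence from non-divisibility by two\<close>

definition double :: "'a \<Rightarrow> bool" where
  "double x \<longleftrightarrow> (\<exists>y\<in>carrier G. x = y \<otimes> y)"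

lemma double_one: "double \<one>"
  unfolding double_def by (intro bexI[of _ \<one>]) simp_all

lemma double_mult:
  assumes "double x" "double y" shows "double (x \<otimes> y)"
proof -
  obtain u v where "u \<in> carrier G" "x = u \<otimes> u" "v \<in> carrier G" "y = v \<otimes> v"
    using assms by (auto simp: double_def)
  then show ?thesis unfolding double_def by (intro bexI[of _ "u \<otimes> v"]) (simp_all add: m_ac)
qed

lemma double_inv: "double x \<Longrightarrow> double (inv x)"
  unfolding double_def by (metis inv_closed inv_mult)

lemma double_mult_iff:
  assumes y: "double y" and x: "x \<in> carrier G" shows "double (x \<otimes> y) \<longleftrightarrow> double x"
proof
  assume "double (x \<otimes> y)"
  then have "double (x \<otimes> y \<otimes> inv y)" by (rule double_mult[OF _ double_inv[OF y]])
  moreover have "y \<in> carrier G" using y by (auto simp: double_def)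
  then have "x \<otimes> y \<otimes> inv y = x" using x by (simp add: m_assoc)
  ultimately show "double x" by metis
next
  assume "double x" then show "double (x \<otimes> y)" using y by (rule double_mult)
qed

lemma double_even_pow: "x \<in> carrier G \<Longrightarrow> double (x [^] (2 * k :: int))"
  unfolding double_def by (intro bexI[of _ "x [^] k"]) (simp_all flip: int_pow_mult)

text \<open>Modulo doubles only the parity of an exponent counts, so arbitrary integer relations
  reduce to finitely many tests.\<close>

lemma double_pow_iff:
  assumes "x \<in> carrier G" "y \<in> carrier G"
  shows "double (y \<otimes> x [^] (k::int)) \<longleftrightarrow> double (y \<otimes> (if even k then \<one> else x))"
proof (cases "even k")
  case True
  then show ?thesis using assms by (auto elim!: evenE simp: double_mult_iff double_even_pow)
next
  case False
  then obtain l where "k = 2 * l + 1" by (rule oddE)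
  then have "y \<otimes> x [^] k = y \<otimes> x \<otimes> x [^] (2 * l)"
    using assms by (simp add: int_pow_mult m_ac)
  then show ?thesis using assms False by (simp add: double_mult_iff double_even_pow)
qed

text \<open>
  In the following two lemmas \<open>H\<close> plays the role of the torsion subgroup: a relation \<open>j p \<in> H\<close> with
  \<open>j\<close> odd is impossible, and one with \<open>j\<close> even can be divided by two.
\<close>

lemma multiple_in_subgroup:
  assumes H: "subgroup H G" and p: "p \<in> carrier G"
    and two: "\<And>x. x \<in> carrier G \<Longrightarrow> x \<otimes> x = \<one> \<Longrightarrow> x \<in> H"
    and pure: "\<And>h. h \<in> H \<Longrightarrow> double h \<Longrightarrow> \<exists>k\<in>H. h = k \<otimes> k"
    and indep: "\<And>h. h \<in> H \<Longrightarrow> \<not> double (p \<otimes> h)"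
  shows "p [^] (j::int) \<in> H \<Longrightarrow> j = 0"
proof (induction "nat \<bar>j\<bar>" arbitrary: j rule: less_induct)
  case less
  show ?case
  proof (cases "even j")
    case True
    then obtain k where j: "j = 2 * k" by (auto elim: evenE)
    then have dbl: "p [^] j = p [^] k \<otimes> p [^] k" using p by (simp flip: int_pow_mult)
    \<comment> \<open>In additive notation: 2 (k p) is a double in H, hence equal to 2 h for some h
      in H. So k p - h is killed by 2, lies in H, and k p lies in H too.\<close>
    then obtain h where h: "h \<in> H" "p [^] k \<otimes> p [^] k = h \<otimes> h"
      using pure[OF less.prems] p by (metis double_def int_pow_closed)
    have hG: "h \<in> carrier G" using h H by (simp add: subgroup.mem_carrier)
    have "(p [^] k \<otimes> inv h) \<otimes> (p [^] k \<otimes> inv h) = (p [^] k \<otimes> p [^] k) \<otimes> inv (h \<otimes> h)"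
      using p hG by (simp add: inv_mult m_ac)
    then have "p [^] k \<otimes> inv h \<in> H" using two p hG h(2) by simp
    then have "p [^] k \<otimes> inv h \<otimes> h \<in> H" using h H by (simp add: subgroup.m_closed)
    then have pk: "p [^] k \<in> H" using p hG by (simp add: m_assoc)
    have "nat \<bar>k\<bar> < nat \<bar>j\<bar>" if "k \<noteq> 0" using that j by linarith
    then have "k = 0" using less.hyps[OF _ pk] by blast
    then show ?thesis using j by simp
  next
    case False
    \<comment> \<open>Additively h + j p = 0 is a double, and for odd j it agrees with h + p modulo
      doubles.\<close>
    define h where "h = inv (p [^] j)"
    have "h \<in> H" using less.prems H by (simp add: h_def subgroup.m_inv_closed)
    then have "\<not> double (h \<otimes> p)" using indep p H by (metis m_comm subgroup.mem_carrier)
    then have "\<not> double (h \<otimes> p [^] j)"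
      using double_pow_iff[of p h j] False p \<open>h \<in> H\<close> H by (simp add: subgroup.mem_carrier)
    moreover have "h \<otimes> p [^] j = \<one>" using p by (simp add: h_def)
    ultimately show ?thesis using double_one by simp
  qed
qed

lemma multiples_in_subgroup:
  assumes H: "subgroup H G" and p: "p \<in> carrier G" and q: "q \<in> carrier G"
    and two: "\<And>x. x \<in> carrier G \<Longrightarrow> x \<otimes> x = \<one> \<Longrightarrow> x \<in> H"
    and pure: "\<And>h. h \<in> H \<Longrightarrow> double h \<Longrightarrow> \<exists>k\<in>H. h = k \<otimes> k"
    and indep: "\<And>h. h \<in> H \<Longrightarrow> \<not> double (p \<otimes> h)" "\<And>h. h \<in> H \<Longrightarrow> \<not> double (q \<otimes> h)"
      "\<And>h. h \<in> H \<Longrightarrow> \<not> double (p \<otimes> q \<otimes> h)"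
  shows "p [^] (i::int) \<otimes> q [^] (j::int) \<in> H \<Longrightarrow> i = 0 \<and> j = 0"
proof (induction "nat (\<bar>i\<bar> + \<bar>j\<bar>)" arbitrary: i j rule: less_induct)
  case less
  show ?case
  proof (cases "even i \<and> even j")
    case True
    then obtain k l where kl: "i = 2 * k" "j = 2 * l" by (meson evenE)
    define r where "r = p [^] k \<otimes> q [^] l"
    have r: "r \<in> carrier G" using p q by (simp add: r_def)
    have "p [^] i = p [^] k \<otimes> p [^] k" "q [^] j = q [^] l \<otimes> q [^] l"
      using p q by (simp_all add: kl flip: int_pow_mult)
    then have dbl: "p [^] i \<otimes> q [^] j = r \<otimes> r" using p q by (simp add: r_def m_ac)
    then obtain h where h: "h \<in> H" "r \<otimes> r = h \<otimes> h"
      using pure[OF less.prems] r by (metis double_def)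
    have hG: "h \<in> carrier G" using h H by (simp add: subgroup.mem_carrier)
    have "(r \<otimes> inv h) \<otimes> (r \<otimes> inv h) = (r \<otimes> r) \<otimes> inv (h \<otimes> h)"
      using r hG by (simp add: inv_mult m_ac)
    then have "r \<otimes> inv h \<in> H" using two r hG h(2) by simp
    then have "r \<otimes> inv h \<otimes> h \<in> H" using h H by (simp add: subgroup.m_closed)
    then have "r \<in> H" using r hG by (simp add: m_assoc)
    then have pq: "p [^] k \<otimes> q [^] l \<in> H" by (simp only: r_def)
    have "nat (\<bar>k\<bar> + \<bar>l\<bar>) < nat (\<bar>i\<bar> + \<bar>j\<bar>)" if "\<not> (k = 0 \<and> l = 0)"
      using that kl by linarith
    then have "k = 0 \<and> l = 0" using less.hyps[OF _ pq] by blast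
    then show ?thesis using kl by simp
  next
    case False
    define h where "h = inv (p [^] i \<otimes> q [^] j)"
    have h: "h \<in> H" using less.prems H by (simp add: h_def subgroup.m_inv_closed)
    have hG: "h \<in> carrier G" using h H by (simp add: subgroup.mem_carrier)
    \<comment> \<open>Reducing the coefficients modulo 2 leaves one of p, q and p + q, shifted by
      h.\<close>
    have "\<not> double (h \<otimes> (if even i then \<one> else p) \<otimes> (if even j then \<one> else q))"
      using False indep[OF h] p q hG by (auto simp: m_ac)
    moreover have "double (h \<otimes> (if even i then \<one> else p) \<otimes> q [^] j)
        \<longleftrightarrow> double (h \<otimes> (if even i then \<one> else p) \<otimes> (if even j then \<one> else q))"
      using p q hG by (intro double_pow_iff) auto
    moreover have "h \<otimes> (if even i then \<one> else p) \<otimes> q [^] j = (h \<otimes> q [^] j) \<otimes> (if even i then \<one> else p)"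
      using p q hG by (auto simp: m_ac)
    moreover have "double ((h \<otimes> q [^] j) \<otimes> p [^] i) \<longleftrightarrow> double ((h \<otimes> q [^] j) \<otimes> (if even i then \<one> else p))"
      using p q hG by (intro double_pow_iff) auto
    moreover have "(h \<otimes> q [^] j) \<otimes> p [^] i = h \<otimes> (p [^] i \<otimes> q [^] j)"
      using p q hG by (simp add: m_ac)
    then have "(h \<otimes> q [^] j) \<otimes> p [^] i = \<one>" using p q by (simp add: h_def)
    ultimately show ?thesis using double_one by metis
  qed
qed

lemma subgroup_int_powers: "x \<in> carrier G \<Longrightarrow> subgroup (range (\<lambda>k::int. x [^] k)) G"
  using group_hom.img_is_subgroup[of integer_group G "\<lambda>k::int. x [^] k"] hom_int_pow
  by (simp add: group_hom_def group_hom_axioms_def is_group)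

lemma subgroup_int_powers2:
  assumes "x \<in> carrier G" "y \<in> carrier G"
  shows "subgroup (range (\<lambda>(i::int, j::int). x [^] i \<otimes> y [^] j)) G"
proof -
  have "(\<lambda>(i, j). x [^] i \<otimes> y [^] j) \<in> hom (integer_group \<times>\<times> integer_group) G"
    using assms by (intro hom_DirProd_mult hom_int_pow)
  then show ?thesis
    using group_hom.img_is_subgroup[of "integer_group \<times>\<times> integer_group" G "\<lambda>(i, j). x [^] i \<otimes> y [^] j"]
    by (simp add: group_hom_def group_hom_axioms_def is_group DirProd_group)
qed

section \<open>Criteria according to the shape of the torsion\<close>

context
  fixes t :: 'a and n :: nat
  assumes t: "t \<in> carrier G" and n: "n > 0" and ord: "\<And>i::int. t [^] i = \<one> \<longleftrightarrow> int n dvd i"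
begin

lemma pow_order: "t [^] n = \<one>"
  using ord[of "int n"] by (simp add: int_pow_int)

text \<open>Doubling is invertible in odd order: for n = 2 l + 1 the inverse of 2 modulo n is l +
  1.\<close>

lemma odd_order_power:
  fixes i :: int
  assumes "odd n" obtains k :: int where "t [^] i = t [^] k \<otimes> t [^] k"
proof -
  obtain l where l: "n = 2 * l + 1" using assms by (rule oddE)
  have "t [^] i = t [^] (i + int n * i)"
    using t pow_order by (simp add: int_pow_mult int_pow_int flip: int_pow_pow)
  also have "i + int n * i = (int l + 1) * i + (int l + 1) * i" by (simp add: l algebra_simps)
  finally have "t [^] i = t [^] ((int l + 1) * i) \<otimes> t [^] ((int l + 1) * i)"
    using t by (simp only: int_pow_mult)
  then show thesis by (rule that)
qed

lemma odd_order_double: "odd n \<Longrightarrow> double (t [^] (i::int))"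
  by (rule odd_order_power[of i]) (use t in \<open>auto simp: double_def\<close>)

text \<open>All powers of t are doubles, so one test of p settles the whole coset of p.\<close>

lemma embed_odd:
  assumes "odd n" and p: "p \<in> carrier G"
    and two: "\<And>x. x \<in> carrier G \<Longrightarrow> x \<otimes> x = \<one> \<Longrightarrow> x = \<one>" and indep: "\<not> double p"
  shows "has_subgroup_isomorphic_to G (integer_mod_group n \<times>\<times> integer_group)"
proof (rule embed_mod_int[OF n t p pow_order])
  fix i j :: int assume rel: "t [^] i \<otimes> p [^] j = \<one>"
  let ?H = "range (\<lambda>k::int. t [^] k)"
  have "p [^] j \<otimes> t [^] i = \<one>" using rel t p by (simp add: m_comm)
  then have "p [^] j = t [^] (- i)" using t p by (simp add: int_pow_neg inv_equality)
  then have "p [^] j \<in> ?H" by blast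
  have "j = 0"
  proof (rule multiple_in_subgroup[OF subgroup_int_powers[OF t] p])
    show "p [^] j \<in> ?H" by fact
    show "x \<in> ?H" if "x \<in> carrier G" "x \<otimes> x = \<one>" for x
      using two[OF that] by (auto intro!: image_eqI[of _ _ 0])
    show "\<exists>k\<in>?H. h = k \<otimes> k" if "h \<in> ?H" for h
      using that odd_order_power[OF \<open>odd n\<close>] by (metis (no_types, lifting) imageE rangeI)
    show "\<not> double (p \<otimes> h)" if "h \<in> ?H" for h
      using that odd_order_double[OF \<open>odd n\<close>] indep p by (auto simp: double_mult_iff)
  qed
  with rel show "int n dvd i \<and> j = 0" using t ord by simp
qed

lemma embed_odd_rank_two:
  assumes "odd n" and p: "p \<in> carrier G" and q: "q \<in> carrier G"
    and two: "\<And>x. x \<in> carrier G \<Longrightarrow> x \<otimes> x = \<one> \<Longrightarrow> x = \<one>"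
    and indep: "\<not> double p" "\<not> double q" "\<not> double (p \<otimes> q)"
  shows "has_subgroup_isomorphic_to G (integer_mod_group n \<times>\<times> integer_group \<times>\<times> integer_group)"
proof (rule embed_mod_int_int[OF n t p q pow_order])
  fix i j k :: int assume rel: "t [^] i \<otimes> (p [^] j \<otimes> q [^] k) = \<one>"
  let ?H = "range (\<lambda>k::int. t [^] k)"
  have "(p [^] j \<otimes> q [^] k) \<otimes> t [^] i = \<one>" using rel t p q by (simp add: m_comm)
  then have "p [^] j \<otimes> q [^] k = t [^] (- i)"
    using t p q by (simp add: int_pow_neg inv_equality)
  then have "p [^] j \<otimes> q [^] k \<in> ?H" by blast
  have "j = 0 \<and> k = 0"
  proof (rule multiples_in_subgroup[OF subgroup_int_powers[OF t] p q])
    show "p [^] j \<otimes> q [^] k \<in> ?H" by fact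
    show "x \<in> ?H" if "x \<in> carrier G" "x \<otimes> x = \<one>" for x
      using two[OF that] by (auto intro!: image_eqI[of _ _ 0])
    show "\<exists>k\<in>?H. h = k \<otimes> k" if "h \<in> ?H" for h
      using that odd_order_power[OF \<open>odd n\<close>] by (metis (no_types, lifting) imageE rangeI)
    show "\<not> double (p \<otimes> h)" "\<not> double (q \<otimes> h)" "\<not> double (p \<otimes> q \<otimes> h)" if "h \<in> ?H" for h
      using that odd_order_double[OF \<open>odd n\<close>] indep p q by (auto simp: double_mult_iff)
  qed
  with rel show "int n dvd i \<and> j = 0 \<and> k = 0" using t ord by simp
qed

text \<open>The tests express independence of t and p modulo doubles. The test of t also shows that
  a double among the powers of t is an even power, hence a double within the subgroup.\<close>

lemma embed_cyclic:
  assumes p: "p \<in> carrier G"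
    and two: "\<And>x. x \<in> carrier G \<Longrightarrow> x \<otimes> x = \<one> \<Longrightarrow> \<exists>i::int. x = t [^] i"
    and indep: "\<not> double t" "\<not> double p" "\<not> double (p \<otimes> t)"
  shows "has_subgroup_isomorphic_to G (integer_mod_group n \<times>\<times> integer_group)"
proof (rule embed_mod_int[OF n t p pow_order])
  fix i j :: int assume rel: "t [^] i \<otimes> p [^] j = \<one>"
  let ?H = "range (\<lambda>k::int. t [^] k)"
  have "p [^] j \<otimes> t [^] i = \<one>" using rel t p by (simp add: m_comm)
  then have "p [^] j = t [^] (- i)" using t p by (simp add: int_pow_neg inv_equality)
  then have "p [^] j \<in> ?H" by blast
  have "j = 0"
  proof (rule multiple_in_subgroup[OF subgroup_int_powers[OF t] p])
    show "p [^] j \<in> ?H" by fact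
    show "x \<in> ?H" if "x \<in> carrier G" "x \<otimes> x = \<one>" for x
      using two[OF that] by blast
    show "\<exists>k\<in>?H. h = k \<otimes> k" if "h \<in> ?H" "double h" for h
    proof -
      obtain i :: int where i: "h = t [^] i" using \<open>h \<in> ?H\<close> by blast
      then have "even i" using double_pow_iff[of t \<one> i] \<open>double h\<close> t indep(1) by (auto split: if_splits)
      then obtain l where "i = l + l" by (metis evenE mult_2)
      then have "h = t [^] l \<otimes> t [^] l" using i t by (simp only: int_pow_mult)
      then show ?thesis by blast
    qed
    show "\<not> double (p \<otimes> h)" if "h \<in> ?H" for h
      using that double_pow_iff[OF t p] indep p by (auto split: if_splits)
  qed
  with rel show "int n dvd i \<and> j = 0" using t ord by simp
qed

text \<open>The tests run over the seven nonzero combinations of s, t and p modulo doubles. They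
  also give the independence of s and t from each other.\<close>

lemma embed_noncyclic:
  assumes s: "s \<in> carrier G" "s \<otimes> s = \<one>" and p: "p \<in> carrier G"
    and two: "\<And>x. x \<in> carrier G \<Longrightarrow> x \<otimes> x = \<one> \<Longrightarrow> \<exists>(i::int) (j::int). x = s [^] i \<otimes> t [^] j"
    and indep: "\<not> double s" "\<not> double t" "\<not> double (s \<otimes> t)"
      "\<not> double p" "\<not> double (p \<otimes> s)" "\<not> double (p \<otimes> t)" "\<not> double (p \<otimes> s \<otimes> t)"
  shows "has_subgroup_isomorphic_to G
    (integer_mod_group 2 \<times>\<times> integer_mod_group n \<times>\<times> integer_group)"
proof (rule embed_mod_mod_int[OF _ n s(1) t p _ pow_order])
  show "(0::nat) < 2" by simp
  show "s [^] (2::nat) = \<one>" using s by (simp add: numeral_2_eq_2)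
  fix i j k :: int assume rel: "s [^] i \<otimes> (t [^] j \<otimes> p [^] k) = \<one>"
  let ?H = "range (\<lambda>(i::int, j::int). s [^] i \<otimes> t [^] j)"
  have dbl: "double (y \<otimes> (s [^] i \<otimes> t [^] j))
      \<longleftrightarrow> double (y \<otimes> (if even i then \<one> else s) \<otimes> (if even j then \<one> else t))"
    if y: "y \<in> carrier G" for y and i j :: int
  proof -
    have "double (y \<otimes> s [^] i \<otimes> t [^] j) \<longleftrightarrow> double (y \<otimes> s [^] i \<otimes> (if even j then \<one> else t))"
      using y s t by (intro double_pow_iff) auto
    also have "y \<otimes> s [^] i \<otimes> (if even j then \<one> else t) = y \<otimes> (if even j then \<one> else t) \<otimes> s [^] i"
      using y s t by (auto simp: m_ac)
    also have "double \<dots> \<longleftrightarrow> double (y \<otimes> (if even j then \<one> else t) \<otimes> (if even i then \<one> else s))"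
      using y s t by (intro double_pow_iff) auto
    also have "y \<otimes> (if even j then \<one> else t) \<otimes> (if even i then \<one> else s)
        = y \<otimes> (if even i then \<one> else s) \<otimes> (if even j then \<one> else t)"
      using y s t by (auto simp: m_ac)
    finally show ?thesis using y s t by (simp add: m_assoc)
  qed
  have H: "subgroup ?H G" using s t by (intro subgroup_int_powers2) auto
  have "p [^] k = s [^] (- i) \<otimes> t [^] (- j)"
  proof -
    have "p [^] k \<otimes> (s [^] i \<otimes> t [^] j) = \<one>" using rel s t p by (simp add: m_ac)
    then have "p [^] k = inv (s [^] i \<otimes> t [^] j)" using s t p by (simp add: inv_equality)
    then show ?thesis using s t by (simp add: inv_mult int_pow_neg)
  qed
  then have pk: "p [^] k \<in> ?H" by (intro image_eqI[of _ _ "(- i, - j)"]) simp_all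
  have "k = 0"
  proof (rule multiple_in_subgroup[OF H p _ _ _ pk])
    show "x \<in> ?H" if "x \<in> carrier G" "x \<otimes> x = \<one>" for x
    proof -
      obtain i j :: int where "x = s [^] i \<otimes> t [^] j" using two[OF \<open>x \<in> carrier G\<close> \<open>x \<otimes> x = \<one>\<close>] by blast
      then show ?thesis by (intro image_eqI[of _ _ "(i, j)"]) simp_all
    qed
    show "\<exists>k\<in>?H. h = k \<otimes> k" if "h \<in> ?H" "double h" for h
    proof -
      obtain i j :: int where h: "h = s [^] i \<otimes> t [^] j" using \<open>h \<in> ?H\<close> by auto
      then have "even i \<and> even j"
        using dbl[of \<one> i j] \<open>double h\<close> s t indep by (auto split: if_splits)
      then obtain k l where "i = k + k" "j = l + l" by (metis evenE mult_2)
      then have "h = (s [^] k \<otimes> t [^] l) \<otimes> (s [^] k \<otimes> t [^] l)"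
        using h s t by (simp only: int_pow_mult) (simp add: m_ac)
      moreover have "s [^] k \<otimes> t [^] l \<in> ?H" by (intro image_eqI[of _ _ "(k, l)"]) simp_all
      ultimately show ?thesis by blast
    qed
    show "\<not> double (p \<otimes> h)" if "h \<in> ?H" for h
      using that dbl[OF p] indep p s t by (auto split: if_splits)
  qed
  with rel have rel': "s [^] i \<otimes> t [^] j = \<one>" using s t by simp
  \<comment> \<open>The identity is a double, so the tests of s, t and s + t force i to be even. As
    s has exponent 2, only a relation for t is left.\<close>
  then have "double (\<one> \<otimes> (s [^] i \<otimes> t [^] j))" using double_one by simp
  then have "even i" using dbl[of \<one> i j] s t indep by (auto split: if_splits)
  then obtain l where l: "i = 2 * l" by (rule evenE)
  have "s [^] i = (s [^] (2::int)) [^] l" using s by (simp add: l int_pow_pow)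
  also have "s [^] (2::int) = s [^] (1 + 1 :: int)" by simp
  also have "\<dots> = \<one>" using s by (simp only: int_pow_mult int_pow_1)
  finally have "t [^] j = \<one>" using rel' s t by simp
  with \<open>k = 0\<close> \<open>even i\<close> show "int 2 dvd i \<and> int n dvd j \<and> k = 0" using ord by simp
qed

end

end

section \<open>Curves over cubic fields\<close>

definition tsub :: "triple \<Rightarrow> triple \<Rightarrow> triple" where
  "tsub x y = tadd x (tscale (- 1) y)"

text \<open>The discriminant of the cubic x^3 + a x^2 + b x + c; that of the curve is 16 times as
  large.\<close>

definition tdisc :: "triple \<Rightarrow> triple \<Rightarrow> triple \<Rightarrow> triple \<Rightarrow> triple" where
  "tdisc m a b c =
     (let ab = tmul m a b; a2 = tmul m a a in
      tadd (tmul m ab ab)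
        (tadd (tscale (- 4) (tmul m b (tmul m b b)))
          (tadd (tscale (- 4) (tmul m c (tmul m a a2)))
            (tadd (tscale (- 27) (tmul m c c)) (tscale 18 (tmul m c ab))))))"

type_synonym tpoint = "triple \<times> triple"

definition on_check :: "triple \<Rightarrow> triple \<Rightarrow> triple \<Rightarrow> triple \<Rightarrow> tpoint \<Rightarrow> bool" where
  "on_check m a b c P \<longleftrightarrow> (let x = fst P; y = snd P; x2 = tmul m x x in
     tmul m y y = tadd (tmul m x x2) (tadd (tmul m a x2) (tadd (tmul m b x) c)))"

text \<open>The line through \<open>P\<close> and \<open>Q\<close> (tangent if \<open>P = Q\<close>) has slope \<open>l / d\<close>.\<close>

definition add_check :: "triple \<Rightarrow> triple \<Rightarrow> triple \<Rightarrow> tpoint \<Rightarrow> tpoint \<Rightarrow> tpoint \<Rightarrow> triple \<Rightarrow> int \<Rightarrow> bool"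
  where
  "add_check m a b P Q R l d \<longleftrightarrow> d \<noteq> 0 \<and>
     (if fst P = fst Q
      then snd P = snd Q \<and> snd P \<noteq> (0, 0, 0) \<and>
        tmul m l (tscale 2 (snd P)) =
          tscale d (tadd (tscale 3 (tmul m (fst P) (fst P))) (tadd (tscale 2 (tmul m a (fst P))) b))
      else tmul m l (tsub (fst Q) (fst P)) = tscale d (tsub (snd Q) (snd P))) \<and>
     tscale (d * d) (tadd (fst R) (tadd a (tadd (fst P) (fst Q)))) = tmul m l l \<and>
     tscale d (tadd (snd R) (snd P)) = tmul m l (tsub (fst P) (fst R))"

text \<open>The polynomial whose roots are the abscissas of the halves of the points with abscissa \<open>x\<close>.\<close>

definition halving_poly :: "triple \<Rightarrow> triple \<Rightarrow> triple \<Rightarrow> triple \<Rightarrow> triple \<Rightarrow> triple list" where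
  "halving_poly m a b c x =
     [tsub (tmul m b b) (tscale 4 (tmul m c (tadd x a))),
      tscale (- 4) (tadd (tscale 2 c) (tmul m b x)),
      tscale (- 2) (tadd b (tscale 2 (tmul m a x))),
      tscale (- 4) x]"

text \<open>An addition chain: \<open>ks\<close> pairs numbers k with the coordinates of k T, and
  each step adds two known multiples along a line whose slope is supplied.\<close>

fun chain :: "triple \<Rightarrow> triple \<Rightarrow> triple \<Rightarrow> (nat \<times> tpoint) list
    \<Rightarrow> (nat \<times> nat \<times> tpoint \<times> triple \<times> int) list \<Rightarrow> (nat \<times> tpoint) list option" where
  "chain m a b ks [] = Some ks"
| "chain m a b ks ((i, j, R, l, d) # steps) =
     (case map_of ks i of None \<Rightarrow> None | Some P \<Rightarrow>
      (case map_of ks j of None \<Rightarrow> None | Some Q \<Rightarrow>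
       if add_check m a b P Q R l d then chain m a b ((i + j, R) # ks) steps else None))"

text \<open>Only affine points have coordinates, so n T = 0 is certified in the form k T = - (n - k)
  T. The order thus divides n; a proper divisor would divide some q in \<open>qs\<close>, but q T is
  affine. The range starts at 2 because 1 divides any member of the nonempty list
  \<open>qs\<close>.\<close>

definition order_check :: "nat \<Rightarrow> nat list \<Rightarrow> nat \<Rightarrow> (nat \<times> tpoint) list \<Rightarrow> bool" where
  "order_check n qs k ks \<longleftrightarrow> k < n \<and>
     (case map_of ks k of None \<Rightarrow> False | Some P \<Rightarrow>
      (case map_of ks (n - k) of None \<Rightarrow> False | Some Q \<Rightarrow>
       fst P = fst Q \<and> tadd (snd P) (snd Q) = (0, 0, 0))) \<and>
     list_all (\<lambda>q. map_of ks q \<noteq> None) qs \<and>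
     qs \<noteq> [] \<and> list_all (\<lambda>d. d dvd n \<longrightarrow> list_ex ((dvd) d) qs) [2..<n]"

section \<open>The Mordell-Weil group of a curve over K\<close>

locale cubic_curve = cubic_field +
  fixes a b c :: triple
  assumes tdisc: "tdisc m a b c \<noteq> (0, 0, 0)"
begin

lemma discriminant_nonzero:
  "(ev a \<alpha> * ev b \<alpha>)\<^sup>2 - 4 * ev b \<alpha> ^ 3 - 4 * ev c \<alpha> * ev a \<alpha> ^ 3 - 27 * (ev c \<alpha>)\<^sup>2
    + 18 * ev c \<alpha> * (ev a \<alpha> * ev b \<alpha>) \<noteq> 0"
proof -
  have "ev (tdisc m a b c) \<alpha> = (ev a \<alpha> * ev b \<alpha>)\<^sup>2 - 4 * ev b \<alpha> ^ 3 - 4 * ev c \<alpha> * ev a \<alpha> ^ 3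
      - 27 * (ev c \<alpha>)\<^sup>2 + 18 * ev c \<alpha> * (ev a \<alpha> * ev b \<alpha>)"
    by (simp add: tdisc_def Let_def ev_tadd ev_tscale ev_mult power2_eq_square power3_eq_cube
        del: ev.simps)
  then show ?thesis using tdisc by (metis ev_eq_0_iff)
qed

sublocale W: short_weierstrass "ev a \<alpha>" "ev b \<alpha>" "ev c \<alpha>"
proof
  fix x
  assume f: "x ^ 3 + ev a \<alpha> * x\<^sup>2 + ev b \<alpha> * x + ev c \<alpha> = 0"
  show "3 * x\<^sup>2 + 2 * ev a \<alpha> * x + ev b \<alpha> \<noteq> 0"
  proof
    assume "3 * x\<^sup>2 + 2 * ev a \<alpha> * x + ev b \<alpha> = 0"
    \<comment> \<open>Once b and c are eliminated through the vanishing of f and its derivative, the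
      discriminant is identically zero.\<close>
    then have b: "ev b \<alpha> = - (3 * x\<^sup>2 + 2 * ev a \<alpha> * x)" by (metis eq_neg_iff_add_eq_0 add.commute)
    have c: "ev c \<alpha> = - (x ^ 3 + ev a \<alpha> * x\<^sup>2 + ev b \<alpha> * x)"
      using f by (metis eq_neg_iff_add_eq_0 add.commute)
    show False using discriminant_nonzero unfolding c b
      by (simp add: algebra_simps power2_eq_square power3_eq_cube del: ev.simps)
  qed
qed

abbreviation G :: "complex point monoid" where "G \<equiv> mordell_weil_group K W.E"

lemma elliptic_curve: "elliptic_curve_over K W.E"
proof -
  have "discriminant W.E = 16 * ((ev a \<alpha> * ev b \<alpha>)\<^sup>2 - 4 * ev b \<alpha> ^ 3 - 4 * ev c \<alpha> * ev a \<alpha> ^ 3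
      - 27 * (ev c \<alpha>)\<^sup>2 + 18 * ev c \<alpha> * (ev a \<alpha> * ev b \<alpha>))"
    by (simp add: discriminant_def b2_def b4_def b6_def b8_def algebra_simps power2_eq_square
        power3_eq_cube del: ev.simps)
  then have "discriminant W.E \<noteq> 0" using discriminant_nonzero by (metis mult_eq_0_iff zero_neq_numeral)
  then show ?thesis by (simp add: elliptic_curve_over_def del: ev.simps)
qed

lemma carrier_G: "P \<in> carrier G \<longleftrightarrow> on_curve W.E P \<and> set_point P \<subseteq> K"
  by (simp add: mordell_weil_group_def rational_points_def)

lemma mult_G [simp]: "P \<otimes>\<^bsub>G\<^esub> Q = point_add W.E P Q" and one_G [simp]: "\<one>\<^bsub>G\<^esub> = Infinity"
  by (simp_all add: mordell_weil_group_def)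

lemma point_add_in_K:
  assumes "set_point P \<subseteq> K" "set_point Q \<subseteq> K" shows "set_point (point_add W.E P Q) \<subseteq> K"
proof (cases P; cases Q)
  fix x1 y1 x2 y2 assume PQ: "P = Affine x1 y1" "Q = Affine x2 y2"
  show ?thesis
  proof (cases "x1 = x2 \<and> y1 + y2 = 0")
    case False
    have K: "x1 \<in> K" "y1 \<in> K" "x2 \<in> K" "y2 \<in> K" using assms PQ by auto
    define l where "l = W.slope x1 y1 x2 y2"
    define x3 where "x3 = l\<^sup>2 - ev a \<alpha> - x1 - x2"
    have "l \<in> K" using K by (simp add: l_def W.slope_def K_closed del: ev.simps)
    then have "x3 \<in> K" using K by (simp add: x3_def K_closed del: ev.simps)
    then show ?thesis unfolding PQ W.add_affine[OF False l_def x3_def]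
      using \<open>l \<in> K\<close> K by (simp add: K_closed)
  qed (simp add: PQ)
qed (use assms in auto)

lemma comm_group_G: "comm_group G"
proof (rule comm_groupI)
  fix P Q R assume "P \<in> carrier G" "Q \<in> carrier G" "R \<in> carrier G"
  then show "P \<otimes>\<^bsub>G\<^esub> Q \<otimes>\<^bsub>G\<^esub> R = P \<otimes>\<^bsub>G\<^esub> (Q \<otimes>\<^bsub>G\<^esub> R)"
    by (simp only: carrier_G mult_G W.add_assoc)
next
  fix P Q assume "P \<in> carrier G" "Q \<in> carrier G"
  then show "P \<otimes>\<^bsub>G\<^esub> Q \<in> carrier G"
    by (simp only: carrier_G mult_G W.on_curve_add point_add_in_K)
next
  fix P Q assume "P \<in> carrier G" "Q \<in> carrier G"
  then show "P \<otimes>\<^bsub>G\<^esub> Q = Q \<otimes>\<^bsub>G\<^esub> P"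
    by (simp only: carrier_G mult_G) (metis W.add_commute)
next
  fix P assume P: "P \<in> carrier G"
  show "\<exists>Q\<in>carrier G. Q \<otimes>\<^bsub>G\<^esub> P = \<one>\<^bsub>G\<^esub>"
  proof (cases P)
    case Infinity then show ?thesis using P by (intro bexI[of _ P]) auto
  next
    case (Affine x y)
    then show ?thesis using P by (intro bexI[of _ "Affine x (- y)"]) (auto simp: carrier_G K_closed)
  qed
qed (auto simp: carrier_G)

sublocale G: comm_group G by (rule comm_group_G)

definition pt :: "tpoint \<Rightarrow> complex point" where
  "pt P = Affine (ev (fst P) \<alpha>) (ev (snd P) \<alpha>)"

lemma pt_not_Infinity [simp]: "pt P \<noteq> Infinity"
  by (simp add: pt_def)

lemma pt_in_carrier:
  assumes "on_check m a b c P" shows "pt P \<in> carrier G"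
proof -
  have "ev (tmul m (snd P) (snd P)) \<alpha> = ev (tadd (tmul m (fst P) (tmul m (fst P) (fst P)))
      (tadd (tmul m a (tmul m (fst P) (fst P))) (tadd (tmul m b (fst P)) c))) \<alpha>"
    using assms by (simp only: on_check_def Let_def)
  then show ?thesis
    by (simp add: carrier_G pt_def ev_tadd ev_mult power2_eq_square power3_eq_cube algebra_simps
        del: ev.simps)
qed

lemma add_check:
  assumes "add_check m a b P Q R l d" shows "pt P \<otimes>\<^bsub>G\<^esub> pt Q = pt R"
proof -
  define x1 y1 x2 y2 x3 y3 where defs: "x1 = ev (fst P) \<alpha>" "y1 = ev (snd P) \<alpha>"
    "x2 = ev (fst Q) \<alpha>" "y2 = ev (snd Q) \<alpha>" "x3 = ev (fst R) \<alpha>" "y3 = ev (snd R) \<alpha>"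
  define s where "s = ev l \<alpha> / of_int d"
  have d: "(of_int d :: complex) \<noteq> 0" using assms by (simp add: add_check_def)
  have l: "ev l \<alpha> = s * of_int d" using d by (simp add: s_def)
  have nopp: "\<not> (x1 = x2 \<and> y1 + y2 = 0)"
  proof (cases "fst P = fst Q")
    case True
    then have "snd P = snd Q" "snd P \<noteq> (0, 0, 0)" using assms unfolding add_check_def by metis+
    then have "y1 = y2" "y1 \<noteq> 0" by (simp_all add: defs del: ev.simps)
    then show ?thesis by (simp flip: mult_2)
  qed (simp add: defs del: ev.simps)
  have slope: "s = W.slope x1 y1 x2 y2"
  proof (cases "fst P = fst Q")
    case True
    then have "snd P \<noteq> (0, 0, 0)" and "tmul m l (tscale 2 (snd P)) =
        tscale d (tadd (tscale 3 (tmul m (fst P) (fst P))) (tadd (tscale 2 (tmul m a (fst P))) b))"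
      using assms unfolding add_check_def by metis+
    then have "snd P \<noteq> (0, 0, 0)" and "ev (tmul m l (tscale 2 (snd P))) \<alpha> =
        ev (tscale d (tadd (tscale 3 (tmul m (fst P) (fst P))) (tadd (tscale 2 (tmul m a (fst P))) b))) \<alpha>"
      by simp_all
    then have "y1 \<noteq> 0" and "of_int d * (s * (2 * y1)) = of_int d * (3 * x1\<^sup>2 + 2 * ev a \<alpha> * x1 + ev b \<alpha>)"
      by (simp_all add: defs ev_tadd ev_tscale ev_mult l power2_eq_square algebra_simps del: ev.simps)
    then have "y1 \<noteq> 0" and "s * (2 * y1) = 3 * x1\<^sup>2 + 2 * ev a \<alpha> * x1 + ev b \<alpha>"
      using d by (simp_all del: ev.simps)
    moreover have "x1 = x2" using True by (simp add: defs del: ev.simps)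
    ultimately show ?thesis by (simp add: W.slope_def eq_divide_eq del: ev.simps)
  next
    case False
    then have "ev (tmul m l (tsub (fst Q) (fst P))) \<alpha> = ev (tscale d (tsub (snd Q) (snd P))) \<alpha>"
      using assms by (simp only: add_check_def if_False)
    then have "of_int d * (s * (x2 - x1)) = of_int d * (y2 - y1)"
      by (simp add: defs tsub_def ev_tadd ev_tscale ev_mult l algebra_simps del: ev.simps)
    moreover have "x1 \<noteq> x2" using False by (simp add: defs del: ev.simps)
    ultimately show ?thesis using d by (simp add: W.slope_def eq_divide_eq)
  qed
  have "ev (tscale (d * d) (tadd (fst R) (tadd a (tadd (fst P) (fst Q))))) \<alpha> = ev (tmul m l l) \<alpha>"
    and "ev (tscale d (tadd (snd R) (snd P))) \<alpha> = ev (tmul m l (tsub (fst P) (fst R))) \<alpha>"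
    using assms by (simp_all only: add_check_def)
  then have "(of_int d)\<^sup>2 * (x3 + (ev a \<alpha> + (x1 + x2))) = (of_int d)\<^sup>2 * s\<^sup>2"
    and "of_int d * (y3 + y1) = of_int d * (s * (x1 - x3))"
    by (simp_all add: defs tsub_def ev_tadd ev_tscale ev_mult l power2_eq_square algebra_simps del: ev.simps)
  then have "x3 + (ev a \<alpha> + (x1 + x2)) = s\<^sup>2" and y3: "y3 + y1 = s * (x1 - x3)" using d by simp_all
  then have "x3 = s\<^sup>2 - ev a \<alpha> - x1 - x2" by (simp add: algebra_simps)
  from W.add_affine[OF nopp slope this] y3 show ?thesis
    by (simp add: pt_def defs[symmetric] algebra_simps eq_neg_iff_add_eq_0 del: ev.simps point_add.simps)
qed

text \<open>This is the duplication formula cleared of denominators: with u the abscissa of P, the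
  quartic equals f'^2 - 4 f (u + a + 2 x), where f' = 2 y l, f = y^2 and u + a + 2 x = l^2 for the
  tangent slope l.\<close>

lemma half_is_root:
  assumes R: "R \<in> carrier G" and eq: "R \<otimes>\<^bsub>G\<^esub> R = pt P"
  shows "\<exists>x\<in>K. hpoly x 1 (map (\<lambda>t. ev t \<alpha>) (halving_poly m a b c (fst P))) = 0"
proof -
  obtain x y where xy: "R = Affine x y" using eq by (cases R) (auto simp: pt_def)
  then have y2: "y\<^sup>2 = x ^ 3 + ev a \<alpha> * x\<^sup>2 + ev b \<alpha> * x + ev c \<alpha>" and "x \<in> K"
    using R by (auto simp: carrier_G simp del: ev.simps)
  have "y \<noteq> 0" using eq xy by (auto simp: pt_def)
  then have nopp: "\<not> (x = x \<and> y + y = 0)" by simp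
  define l where "l = W.slope x y x y"
  define u where "u = ev (fst P) \<alpha>"
  have "u = l\<^sup>2 - ev a \<alpha> - x - x"
    using W.add_affine[OF nopp l_def refl] eq xy by (simp add: u_def pt_def del: ev.simps point_add.simps)
  then have u: "u + ev a \<alpha> + 2 * x = l\<^sup>2" by simp
  have l: "3 * x\<^sup>2 + 2 * ev a \<alpha> * x + ev b \<alpha> = l * (2 * y)"
    using \<open>y \<noteq> 0\<close> by (simp add: l_def W.slope_def)
  have "hpoly x 1 (map (\<lambda>t. ev t \<alpha>) (halving_poly m a b c (fst P)))
    = (3 * x\<^sup>2 + 2 * ev a \<alpha> * x + ev b \<alpha>)\<^sup>2
      - 4 * (x ^ 3 + ev a \<alpha> * x\<^sup>2 + ev b \<alpha> * x + ev c \<alpha>) * (u + ev a \<alpha> + 2 * x)"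
    by (simp add: halving_poly_def tsub_def ev_tadd ev_tscale ev_mult u_def[symmetric] algebra_simps
        power2_eq_square power3_eq_cube del: ev.simps)
  also have "\<dots> = 0" unfolding y2[symmetric] u l by (simp add: power_mult_distrib)
  finally show ?thesis using \<open>x \<in> K\<close> by blast
qed

lemma not_double:
  assumes "no_root_mod m p r (halving_poly m a b c (fst P))" shows "\<not> G.double (pt P)"
proof
  assume "G.double (pt P)"
  then obtain R where "R \<in> carrier G" "R \<otimes>\<^bsub>G\<^esub> R = pt P" unfolding G.double_def by metis
  then show False using half_is_root no_root[OF assms] by blast
qed

lemma two_torsion:
  assumes "R \<in> carrier G" "R \<otimes>\<^bsub>G\<^esub> R = \<one>\<^bsub>G\<^esub>"
  obtains "R = \<one>\<^bsub>G\<^esub>"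
  | x where "x \<in> K" "R = Affine x 0" "x ^ 3 + ev a \<alpha> * x\<^sup>2 + ev b \<alpha> * x + ev c \<alpha> = 0"
proof (cases R)
  case Infinity then show thesis using that(1) by simp
next
  case (Affine x y)
  have "y = 0" using assms(2) Affine by (auto simp: Let_def split: if_splits)
  then show thesis using that(2) assms(1) Affine by (auto simp: carrier_G simp del: ev.simps)
qed

lemma chain:
  assumes "chain m a b ks steps = Some ks'" and T: "T \<in> carrier G"
    and "\<And>k P. (k, P) \<in> set ks \<Longrightarrow> T [^]\<^bsub>G\<^esub> k = pt P" and "map_of ks' k = Some P"
  shows "T [^]\<^bsub>G\<^esub> k = pt P"
  using assms(1,3)
proof (induction steps arbitrary: ks)
  case Nil then show ?case using map_of_SomeD[OF assms(4)] by simp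
next
  case (Cons step steps)
  obtain i j R l d where step: "step = (i, j, R, l, d)" by (cases step)
  from Cons.prems(1) obtain P Q where PQ: "map_of ks i = Some P" "map_of ks j = Some Q"
    "add_check m a b P Q R l d" "chain m a b ((i + j, R) # ks) steps = Some ks'"
    by (auto simp: step split: option.splits if_splits)
  have "T [^]\<^bsub>G\<^esub> (i + j) = T [^]\<^bsub>G\<^esub> i \<otimes>\<^bsub>G\<^esub> T [^]\<^bsub>G\<^esub> j" using T by (simp only: G.nat_pow_mult)
  also have "\<dots> = pt R" using Cons.prems(2) PQ add_check by (metis map_of_SomeD)
  finally have "T [^]\<^bsub>G\<^esub> (i + j) = pt R" .
  then show ?case using Cons.prems(2) by (intro Cons.IH[OF PQ(4)]) (metis prod.inject set_ConsD)
qed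

lemma order_check:
  assumes T: "on_check m a b c T" and ks: "chain m a b [(1, T)] steps = Some ks"
    and check: "order_check n qs k ks"
  shows "pt T [^]\<^bsub>G\<^esub> (i::int) = \<one>\<^bsub>G\<^esub> \<longleftrightarrow> int n dvd i"
proof -
  have TG: "pt T \<in> carrier G" using T by (rule pt_in_carrier)
  have pow: "pt T [^]\<^bsub>G\<^esub> k = pt P" if "map_of ks k = Some P" for k P
    by (rule chain[OF ks TG _ that]) (use TG in auto)
  obtain P Q where PQ: "map_of ks k = Some P" "map_of ks (n - k) = Some Q"
    "fst P = fst Q" "tadd (snd P) (snd Q) = (0, 0, 0)" and "k < n"
    using check by (auto simp: order_check_def split: option.splits)
  have "ev (snd P) \<alpha> + ev (snd Q) \<alpha> = 0" unfolding ev_tadd[symmetric] PQ(4) by simp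
  then have "pt P \<otimes>\<^bsub>G\<^esub> pt Q = \<one>\<^bsub>G\<^esub>" using PQ(3) by (simp add: pt_def)
  then have "pt T [^]\<^bsub>G\<^esub> (k + (n - k)) = \<one>\<^bsub>G\<^esub>"
    using pow[OF PQ(1)] pow[OF PQ(2)] TG by (simp only: G.nat_pow_mult[symmetric])
  then have "G.ord (pt T) dvd n" using \<open>k < n\<close> TG by (simp only: G.pow_eq_id[symmetric]) simp
  moreover have "G.ord (pt T) = n"
  proof (rule ccontr)
    assume neq: "G.ord (pt T) \<noteq> n"
    have "n > 0" using \<open>k < n\<close> by simp
    then have "G.ord (pt T) = 1 \<or> G.ord (pt T) \<in> set [2..<n]"
      using calculation neq dvd_imp_le[of "G.ord (pt T)" n] by (cases "G.ord (pt T)") auto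
    moreover have "qs \<noteq> []" using check by (simp add: order_check_def)
    then have "\<exists>q\<in>set qs. 1 dvd q" by (intro bexI[of _ "hd qs"]) simp_all
    ultimately obtain q where "q \<in> set qs" "G.ord (pt T) dvd q"
      using check \<open>G.ord (pt T) dvd n\<close> by (auto simp: order_check_def list_all_iff list_ex_iff)
    moreover from this obtain P where "map_of ks q = Some P"
      using check by (auto simp: order_check_def list_all_iff)
    ultimately show False using pow TG G.pow_eq_id[OF TG, of q] by simp
  qed
  ultimately show ?thesis using G.int_pow_eq_id[OF TG] by metis
qed

lemma chain_pow:
  assumes "on_check m a b c T" "chain m a b [(1, T)] steps = Some ks" "map_of ks k = Some P"
  shows "pt P = pt T [^]\<^bsub>G\<^esub> int k"
proof -
  have TG: "pt T \<in> carrier G" using assms(1) by (rule pt_in_carrier)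
  have "pt T [^]\<^bsub>G\<^esub> k = pt P" by (rule chain[OF assms(2) TG _ assms(3)]) (use TG in auto)
  then show ?thesis by (simp add: int_pow_int)
qed

end

section \<open>Combined certificates for each type of group\<close>

type_synonym step = "nat \<times> nat \<times> tpoint \<times> triple \<times> int"

text \<open>
  A reduction \<open>(p, r)\<close> is the ring homomorphism from \<open>\<int>[\<alpha>]\<close> to the field with \<open>p\<close> elements that sends
  \<open>\<alpha>\<close> to \<open>r\<close>.
\<close>

type_synonym reduction = "int \<times> int"

definition no_root_red :: "triple \<Rightarrow> triple list \<Rightarrow> reduction \<Rightarrow> bool" where
  "no_root_red m cs pr = no_root_mod m (fst pr) (snd pr) cs"

definition not_double_check :: "triple \<Rightarrow> triple \<Rightarrow> triple \<Rightarrow> triple \<Rightarrow> tpoint \<times> reduction \<Rightarrow> bool" where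
  "not_double_check m a b c Pr \<longleftrightarrow> no_root_red m (halving_poly m a b c (fst (fst Pr))) (snd Pr)"

definition torsion_check :: "triple \<Rightarrow> triple \<Rightarrow> triple \<Rightarrow> triple \<Rightarrow> nat \<Rightarrow> nat list \<Rightarrow> nat \<Rightarrow>
    tpoint \<Rightarrow> step list \<Rightarrow> (nat \<times> tpoint) list \<Rightarrow> bool" where
  "torsion_check m a b c n qs k T steps js \<longleftrightarrow> on_check m a b c T \<and>
     (case chain m a b [(1, T)] steps of None \<Rightarrow> False | Some ks \<Rightarrow>
        order_check n qs k ks \<and> list_all (\<lambda>(j, P). map_of ks j = Some P) js)"

text \<open>The list \<open>[c, b, a]\<close> encodes f itself, whose roots in K are the abscissas
  of the points of order two. As n is odd, P is the only point to be tested for halves.\<close>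

definition odd_check :: "triple \<Rightarrow> triple \<Rightarrow> triple \<Rightarrow> triple \<Rightarrow> nat \<Rightarrow> nat list \<Rightarrow> nat \<Rightarrow>
    tpoint \<Rightarrow> step list \<Rightarrow> reduction \<Rightarrow> tpoint \<Rightarrow> reduction \<Rightarrow> bool" where
  "odd_check m a b c n qs k T steps pr P pr1 \<longleftrightarrow>
     tdisc m a b c \<noteq> (0, 0, 0) \<and> odd n \<and> torsion_check m a b c n qs k T steps [] \<and>
     no_root_red m [c, b, a] pr \<and> on_check m a b c P \<and> not_double_check m a b c (P, pr1)"

definition odd_rank_two_check :: "triple \<Rightarrow> triple \<Rightarrow> triple \<Rightarrow> triple \<Rightarrow> nat \<Rightarrow> nat list \<Rightarrow> nat \<Rightarrow>
    tpoint \<Rightarrow> step list \<Rightarrow> reduction \<Rightarrow> tpoint \<Rightarrow> reduction \<Rightarrow> tpoint \<Rightarrow> reduction \<Rightarrow>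
    tpoint \<Rightarrow> triple \<Rightarrow> int \<Rightarrow> reduction \<Rightarrow> bool" where
  "odd_rank_two_check m a b c n qs k T steps pr P pr1 Q pr2 R l d pr3 \<longleftrightarrow>
     odd_check m a b c n qs k T steps pr P pr1 \<and> on_check m a b c Q \<and>
     add_check m a b P Q R l d \<and>
     not_double_check m a b c (Q, pr2) \<and> not_double_check m a b c (R, pr3)"

text \<open>The curve is placed so that the point (n / 2) T of order two is the origin, whence c =
  0. Further points of order two would have as abscissas roots of x^2 + a x + b.\<close>

definition cyclic_check :: "triple \<Rightarrow> triple \<Rightarrow> triple \<Rightarrow> nat \<Rightarrow> nat list \<Rightarrow> nat \<Rightarrow>
    tpoint \<Rightarrow> step list \<Rightarrow> reduction \<Rightarrow> reduction \<Rightarrow> tpoint \<Rightarrow> reduction \<Rightarrow>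
    tpoint \<Rightarrow> triple \<Rightarrow> int \<Rightarrow> reduction \<Rightarrow> bool" where
  "cyclic_check m a b n qs k T steps pr pr0 P pr1 R l d pr2 \<longleftrightarrow>
     tdisc m a b (0, 0, 0) \<noteq> (0, 0, 0) \<and>
     torsion_check m a b (0, 0, 0) n qs k T steps [(n div 2, ((0, 0, 0), (0, 0, 0)))] \<and>
     no_root_red m [b, a] pr \<and> on_check m a b (0, 0, 0) P \<and> add_check m a b P T R l d \<and>
     list_all (not_double_check m a b (0, 0, 0)) [(T, pr0), (P, pr1), (R, pr2)]"

text \<open>
  The 2-torsion points have the abscissas \<open>e\<^sub>1\<close>, \<open>e\<^sub>2\<close>, \<open>e\<^sub>3\<close>, and the first one is a multiple of \<open>T\<close>;
  \<open>S\<close> is the second one. Modulo doubles, \<open>T\<close> may be replaced by its odd multiple \<open>U = j T\<close>.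
\<close>

definition noncyclic_check :: "triple \<Rightarrow> triple \<Rightarrow> triple \<Rightarrow> triple \<Rightarrow> triple \<Rightarrow> triple \<Rightarrow> triple \<Rightarrow>
    nat \<Rightarrow> nat list \<Rightarrow> nat \<Rightarrow> tpoint \<Rightarrow> step list \<Rightarrow> nat \<Rightarrow> tpoint \<Rightarrow> reduction \<Rightarrow> reduction \<Rightarrow>
    tpoint \<Rightarrow> triple \<Rightarrow> int \<Rightarrow> reduction \<Rightarrow> tpoint \<Rightarrow> reduction \<Rightarrow>
    tpoint \<Rightarrow> triple \<Rightarrow> int \<Rightarrow> reduction \<Rightarrow> tpoint \<Rightarrow> triple \<Rightarrow> int \<Rightarrow> reduction \<Rightarrow>
    tpoint \<Rightarrow> triple \<Rightarrow> int \<Rightarrow> reduction \<Rightarrow> bool" where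
  "noncyclic_check m a b c e1 e2 e3 n qs k T steps j U prS prU SU l1 d1 prSU P prP
      PS l2 d2 prPS PU l3 d3 prPU PSU l4 d4 prPSU \<longleftrightarrow>
     (let S = (e2, (0, 0, 0)) in
     tdisc m a b c \<noteq> (0, 0, 0) \<and> odd j \<and>
     torsion_check m a b c n qs k T steps [(n div 2, (e1, (0, 0, 0))), (j, U)] \<and>
     a = tscale (- 1) (tadd e1 (tadd e2 e3)) \<and>
     b = tadd (tmul m e1 e2) (tadd (tmul m e1 e3) (tmul m e2 e3)) \<and>
     c = tscale (- 1) (tmul m e1 (tmul m e2 e3)) \<and>
     on_check m a b c S \<and> on_check m a b c P \<and>
     add_check m a b S (e1, (0, 0, 0)) (e3, (0, 0, 0)) (0, 0, 0) 1 \<and>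
     add_check m a b S U SU l1 d1 \<and> add_check m a b P S PS l2 d2 \<and>
     add_check m a b P U PU l3 d3 \<and> add_check m a b PS U PSU l4 d4 \<and>
     list_all (not_double_check m a b c)
       [(S, prS), (U, prU), (SU, prSU), (P, prP), (PS, prPS), (PU, prPU), (PSU, prPSU)])"

context cubic_curve
begin

lemma torsion_check:
  assumes "torsion_check m a b c n qs k T steps js"
  shows "pt T \<in> carrier G" and "n > 0" and "pt T [^]\<^bsub>G\<^esub> (i::int) = \<one>\<^bsub>G\<^esub> \<longleftrightarrow> int n dvd i"
    and "(j, P) \<in> set js \<Longrightarrow> pt P = pt T [^]\<^bsub>G\<^esub> int j"
proof -
  obtain ks where on: "on_check m a b c T" and ks: "chain m a b [(1, T)] steps = Some ks"
    "order_check n qs k ks" "list_all (\<lambda>(j, P). map_of ks j = Some P) js"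
    using assms by (auto simp: torsion_check_def split: option.splits)
  show "pt T \<in> carrier G" using on by (rule pt_in_carrier)
  show "n > 0" using ks(2) by (auto simp: order_check_def)
  show "pt T [^]\<^bsub>G\<^esub> (i::int) = \<one>\<^bsub>G\<^esub> \<longleftrightarrow> int n dvd i" using order_check[OF on ks(1,2)] .
  show "pt P = pt T [^]\<^bsub>G\<^esub> int j" if "(j, P) \<in> set js"
    using that ks(3) by (intro chain_pow[OF on ks(1)]) (auto simp: list_all_iff)
qed

lemma not_double_check: "not_double_check m a b c (P, pr) \<Longrightarrow> \<not> G.double (pt P)"
  unfolding not_double_check_def no_root_red_def by (rule not_double) simp

lemma no_two_torsion:
  assumes "no_root_red m [c, b, a] pr" "x \<in> carrier G" "x \<otimes>\<^bsub>G\<^esub> x = \<one>\<^bsub>G\<^esub>" shows "x = \<one>\<^bsub>G\<^esub>"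
proof (rule two_torsion[OF assms(2,3)])
  fix z assume z: "z \<in> K" "z ^ 3 + ev a \<alpha> * z\<^sup>2 + ev b \<alpha> * z + ev c \<alpha> = 0"
  have "hpoly z 1 (map (\<lambda>t. ev t \<alpha>) [c, b, a]) = z ^ 3 + ev a \<alpha> * z\<^sup>2 + ev b \<alpha> * z + ev c \<alpha>"
    by (simp add: algebra_simps power2_eq_square power3_eq_cube del: ev.simps)
  then show ?thesis using no_root[OF _ z(1)] assms(1) z(2) unfolding no_root_red_def by metis
qed

lemma odd_case:
  assumes "odd_check m a b c n qs k T steps pr P pr1"
  shows "has_subgroup_isomorphic_to G (integer_mod_group n \<times>\<times> integer_group)"
proof -
  have tors: "torsion_check m a b c n qs k T steps []" and "odd n"
    and two: "no_root_red m [c, b, a] pr"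
    and P: "on_check m a b c P" "not_double_check m a b c (P, pr1)"
    using assms by (auto simp: odd_check_def)
  show ?thesis
    by (rule G.embed_odd[OF torsion_check(1-3)[OF tors] \<open>odd n\<close> pt_in_carrier[OF P(1)]
          no_two_torsion[OF two] not_double_check[OF P(2)]])
qed

lemma odd_rank_two_case:
  assumes "odd_rank_two_check m a b c n qs k T steps pr P pr1 Q pr2 R l d pr3"
  shows "has_subgroup_isomorphic_to G (integer_mod_group n \<times>\<times> integer_group \<times>\<times> integer_group)"
proof -
  have tors: "torsion_check m a b c n qs k T steps []" and "odd n"
    and two: "no_root_red m [c, b, a] pr"
    and P: "on_check m a b c P" "not_double_check m a b c (P, pr1)"
    and Q: "on_check m a b c Q" "not_double_check m a b c (Q, pr2)"
    and R: "add_check m a b P Q R l d" "not_double_check m a b c (R, pr3)"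
    using assms by (auto simp: odd_check_def odd_rank_two_check_def)
  have PQ: "\<not> G.double (pt P \<otimes>\<^bsub>G\<^esub> pt Q)"
    unfolding add_check[OF R(1)] by (rule not_double_check[OF R(2)])
  show ?thesis
    by (rule G.embed_odd_rank_two[OF torsion_check(1-3)[OF tors] \<open>odd n\<close> pt_in_carrier[OF P(1)]
          pt_in_carrier[OF Q(1)] no_two_torsion[OF two] not_double_check[OF P(2)]
          not_double_check[OF Q(2)] PQ])
qed

lemma cyclic_case:
  assumes "cyclic_check m a b n qs k T steps pr pr0 P pr1 R l d pr2" and c: "c = (0, 0, 0)"
  shows "has_subgroup_isomorphic_to G (integer_mod_group n \<times>\<times> integer_group)"
proof -
  have tors: "torsion_check m a b c n qs k T steps [(n div 2, ((0, 0, 0), (0, 0, 0)))]"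
    and two: "no_root_red m [b, a] pr" and P: "on_check m a b c P"
    and R: "add_check m a b P T R l d"
    and nd: "not_double_check m a b c (T, pr0)" "not_double_check m a b c (P, pr1)"
      "not_double_check m a b c (R, pr2)"
    using assms by (auto simp: cyclic_check_def)
  have two': "\<exists>i::int. x = pt T [^]\<^bsub>G\<^esub> i" if x: "x \<in> carrier G" "x \<otimes>\<^bsub>G\<^esub> x = \<one>\<^bsub>G\<^esub>" for x
  proof (rule two_torsion[OF x])
    assume "x = \<one>\<^bsub>G\<^esub>"
    then have "x = pt T [^]\<^bsub>G\<^esub> (0::int)" by simp
    then show ?thesis by blast
  next
    fix z assume z: "z \<in> K" "x = Affine z 0" "z ^ 3 + ev a \<alpha> * z\<^sup>2 + ev b \<alpha> * z + ev c \<alpha> = 0"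
    have "z ^ 3 + ev a \<alpha> * z\<^sup>2 + ev b \<alpha> * z + ev c \<alpha> = z * hpoly z 1 (map (\<lambda>t. ev t \<alpha>) [b, a])"
      by (simp add: c algebra_simps power2_eq_square power3_eq_cube)
    then have "z = 0" using z(3) no_root[OF _ z(1)] two unfolding no_root_red_def by (metis mult_eq_0_iff)
    then have "x = pt ((0, 0, 0), (0, 0, 0))" using z(2) by (simp add: pt_def)
    then show ?thesis using torsion_check(4)[OF tors] by (metis list.set_intros(1))
  qed
  have PT: "\<not> G.double (pt P \<otimes>\<^bsub>G\<^esub> pt T)"
    unfolding add_check[OF R] by (rule not_double_check[OF nd(3)])
  show ?thesis
    by (rule G.embed_cyclic[OF torsion_check(1-3)[OF tors] pt_in_carrier[OF P] two'
          not_double_check[OF nd(1)] not_double_check[OF nd(2)] PT])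
qed

lemma noncyclic_case:
  assumes "noncyclic_check m a b c e1 e2 e3 n qs k T steps j U prS prU SU l1 d1 prSU P prP
      PS l2 d2 prPS PU l3 d3 prPU PSU l4 d4 prPSU"
  shows "has_subgroup_isomorphic_to G
    (integer_mod_group 2 \<times>\<times> integer_mod_group n \<times>\<times> integer_group)"
proof -
  define S where "S = (e2, (0, 0, 0) :: triple)"
  have "odd j" and tors: "torsion_check m a b c n qs k T steps [(n div 2, (e1, (0, 0, 0))), (j, U)]"
    and abc: "a = tscale (- 1) (tadd e1 (tadd e2 e3))"
      "b = tadd (tmul m e1 e2) (tadd (tmul m e1 e3) (tmul m e2 e3))"
      "c = tscale (- 1) (tmul m e1 (tmul m e2 e3))"
    and on: "on_check m a b c S" "on_check m a b c P"
    and add: "add_check m a b S (e1, (0, 0, 0)) (e3, (0, 0, 0)) (0, 0, 0) 1" "add_check m a b S U SU l1 d1"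
      "add_check m a b P S PS l2 d2" "add_check m a b P U PU l3 d3" "add_check m a b PS U PSU l4 d4"
    and nd: "not_double_check m a b c (S, prS)" "not_double_check m a b c (U, prU)"
      "not_double_check m a b c (SU, prSU)" "not_double_check m a b c (P, prP)"
      "not_double_check m a b c (PS, prPS)" "not_double_check m a b c (PU, prPU)"
      "not_double_check m a b c (PSU, prPSU)"
    using assms unfolding noncyclic_check_def Let_def S_def list.pred_inject by blast+
  note adds = add[THEN add_check]
  have TG: "pt T \<in> carrier G" and SG: "pt S \<in> carrier G"
    using torsion_check(1)[OF tors] pt_in_carrier[OF on(1)] by blast+
  have two: "\<exists>(i::int) (j::int). x = pt S [^]\<^bsub>G\<^esub> i \<otimes>\<^bsub>G\<^esub> pt T [^]\<^bsub>G\<^esub> j"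
    if x: "x \<in> carrier G" "x \<otimes>\<^bsub>G\<^esub> x = \<one>\<^bsub>G\<^esub>" for x
  proof (rule two_torsion[OF x])
    assume "x = \<one>\<^bsub>G\<^esub>"
    then have "x = pt S [^]\<^bsub>G\<^esub> (0::int) \<otimes>\<^bsub>G\<^esub> pt T [^]\<^bsub>G\<^esub> (0::int)" by simp
    then show ?thesis by blast
  next
    fix z assume z: "z \<in> K" "x = Affine z 0" "z ^ 3 + ev a \<alpha> * z\<^sup>2 + ev b \<alpha> * z + ev c \<alpha> = 0"
    have "z ^ 3 + ev a \<alpha> * z\<^sup>2 + ev b \<alpha> * z + ev c \<alpha>
        = (z - ev e1 \<alpha>) * ((z - ev e2 \<alpha>) * (z - ev e3 \<alpha>))"
      unfolding abc
      by (simp add: ev_tadd ev_tscale ev_mult algebra_simps power2_eq_square power3_eq_cube del: ev.simps)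
    then have "z = ev e1 \<alpha> \<or> z = ev e2 \<alpha> \<or> z = ev e3 \<alpha>"
      using z(3) by (simp del: ev.simps)
    then have "x = pt (e1, (0, 0, 0)) \<or> x = pt S \<or> x = pt (e3, (0, 0, 0))"
      using z(2) by (auto simp: pt_def S_def simp del: ev.simps)
    moreover have e1: "pt (e1, (0, 0, 0)) = pt T [^]\<^bsub>G\<^esub> int (n div 2)"
      by (rule torsion_check(4)[OF tors]) simp
    moreover have "pt (e1, (0, 0, 0)) = pt S [^]\<^bsub>G\<^esub> (0::int) \<otimes>\<^bsub>G\<^esub> pt T [^]\<^bsub>G\<^esub> int (n div 2)"
      unfolding e1 using TG by simp
    moreover have "pt S = pt S [^]\<^bsub>G\<^esub> (1::int) \<otimes>\<^bsub>G\<^esub> pt T [^]\<^bsub>G\<^esub> (0::int)"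
    proof -
      have "pt T [^]\<^bsub>G\<^esub> (0::int) = \<one>\<^bsub>G\<^esub>" by simp
      then show ?thesis by (simp only: G.int_pow_1[OF SG] G.r_one[OF SG])
    qed
    \<comment> \<open>The chord through two points of order two is the x-axis, so their sum is the
      third one.\<close>
    moreover have "pt (e3, (0, 0, 0)) = pt S [^]\<^bsub>G\<^esub> (1::int) \<otimes>\<^bsub>G\<^esub> pt T [^]\<^bsub>G\<^esub> int (n div 2)"
      unfolding adds(1)[symmetric] e1 using SG by (simp only: G.int_pow_1)
    ultimately show ?thesis by metis
  qed
  have SS: "pt S \<otimes>\<^bsub>G\<^esub> pt S = \<one>\<^bsub>G\<^esub>" by (simp add: pt_def S_def)
  have U: "pt U = pt T [^]\<^bsub>G\<^esub> int j" by (rule torsion_check(4)[OF tors]) simp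
  have PG: "pt P \<in> carrier G" using on(2) by (rule pt_in_carrier)
  have dbl: "G.double (y \<otimes>\<^bsub>G\<^esub> pt T) \<longleftrightarrow> G.double (y \<otimes>\<^bsub>G\<^esub> pt U)" if "y \<in> carrier G" for y
    using G.double_pow_iff[OF TG that, of "int j"] \<open>odd j\<close> unfolding U by simp
  have "\<not> G.double (\<one>\<^bsub>G\<^esub> \<otimes>\<^bsub>G\<^esub> pt T)" "\<not> G.double (pt S \<otimes>\<^bsub>G\<^esub> pt T)"
    "\<not> G.double (pt P \<otimes>\<^bsub>G\<^esub> pt T)" "\<not> G.double (pt P \<otimes>\<^bsub>G\<^esub> pt S \<otimes>\<^bsub>G\<^esub> pt T)"
    unfolding dbl[OF G.one_closed] dbl[OF SG] dbl[OF PG] dbl[OF G.m_closed[OF PG SG]]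
    unfolding adds(2-5) using nd[THEN not_double_check] by simp_all
  moreover have "\<one>\<^bsub>G\<^esub> \<otimes>\<^bsub>G\<^esub> pt T = pt T" using TG by (rule G.l_one)
  ultimately have sums: "\<not> G.double (pt T)" "\<not> G.double (pt S \<otimes>\<^bsub>G\<^esub> pt T)"
    "\<not> G.double (pt P \<otimes>\<^bsub>G\<^esub> pt T)" "\<not> G.double (pt P \<otimes>\<^bsub>G\<^esub> pt S \<otimes>\<^bsub>G\<^esub> pt T)" by metis+
  have PS: "\<not> G.double (pt P \<otimes>\<^bsub>G\<^esub> pt S)"
    unfolding adds(3) by (rule nd(5)[THEN not_double_check])
  show ?thesis
    by (rule G.embed_noncyclic[OF torsion_check(1-3)[OF tors] SG SS PG two
          nd(1)[THEN not_double_check] sums(1,2) nd(4)[THEN not_double_check] PS sums(3,4)])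
qed

end

section \<open>Examples\<close>

text \<open>
  The curves come from cubic points on the modular curves that parametrise the torsion structures,
  and the points of infinite order from a search for points of small height.
\<close>

definition irreducible_check :: "int \<Rightarrow> triple \<Rightarrow> bool" where
  "irreducible_check q m \<longleftrightarrow> q > 0 \<and> list_all (\<lambda>n. \<not> q dvd n ^ 3 - ev m n) [0..q - 1]"

lemma exists_cubic_curve:
  assumes "irreducible_check q m" "tdisc m a b c \<noteq> (0, 0, 0)"
  obtains \<alpha> where "cubic_curve m \<alpha> a b c"
proof -
  obtain \<alpha> where "cubic_field m \<alpha>"
    using exists_cubic_field[of q m] assms(1) by (auto simp: irreducible_check_def list_all_iff)
  then have "cubic_curve m \<alpha> a b c" using assms(2) by (simp add: cubic_curve_def cubic_curve_axioms_def)
  then show thesis by (rule that)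
qed

text \<open>Unfolding these turns a certificate into arithmetic with integer literals;
  \<open>upto.simps\<close> expands the ranges of residues so that each is tried.\<close>

lemmas check_simps = irreducible_check_def odd_check_def odd_rank_two_check_def cyclic_check_def
  noncyclic_check_def torsion_check_def order_check_def on_check_def add_check_def halving_poly_def
  not_double_check_def no_root_red_def no_root_mod_def no_root_int_def
  tdisc_def tsub_def Let_def upto.simps

lemma odd_example:
  assumes "irreducible_check q m" and check: "odd_check m a b c n qs k T steps pr P pr1"
  shows "\<exists>K E. cubic_number_field K \<and> elliptic_curve_over K E \<and>
    has_subgroup_isomorphic_to (mordell_weil_group K E) (integer_mod_group n \<times>\<times> integer_group)"
proof -
  obtain \<alpha> where "cubic_curve m \<alpha> a b c"
    using exists_cubic_curve[OF assms(1)] check unfolding odd_check_def by blast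
  then interpret cubic_curve m \<alpha> a b c .
  show ?thesis using cubic_number_field_K elliptic_curve odd_case[OF check] by blast
qed

lemma odd_rank_two_example:
  assumes "irreducible_check q m"
    and check: "odd_rank_two_check m a b c n qs k T steps pr P pr1 Q pr2 R l d pr3"
  shows "\<exists>K E. cubic_number_field K \<and> elliptic_curve_over K E \<and>
    has_subgroup_isomorphic_to (mordell_weil_group K E)
      (integer_mod_group n \<times>\<times> integer_group \<times>\<times> integer_group)"
proof -
  obtain \<alpha> where "cubic_curve m \<alpha> a b c"
    using exists_cubic_curve[OF assms(1)] check unfolding odd_rank_two_check_def odd_check_def by blast
  then interpret cubic_curve m \<alpha> a b c .
  show ?thesis using cubic_number_field_K elliptic_curve odd_rank_two_case[OF check] by blast
qed

lemma cyclic_example: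
  assumes "irreducible_check q m"
    and check: "cyclic_check m a b n qs k T steps pr pr0 P pr1 R l d pr2"
  shows "\<exists>K E. cubic_number_field K \<and> elliptic_curve_over K E \<and>
    has_subgroup_isomorphic_to (mordell_weil_group K E) (integer_mod_group n \<times>\<times> integer_group)"
proof -
  obtain \<alpha> where "cubic_curve m \<alpha> a b (0, 0, 0)"
    using exists_cubic_curve[OF assms(1)] check unfolding cyclic_check_def by blast
  then interpret cubic_curve m \<alpha> a b "(0, 0, 0)" .
  show ?thesis using cubic_number_field_K elliptic_curve cyclic_case[OF check refl] by blast
qed

lemma noncyclic_example:
  assumes "irreducible_check q m"
    and check: "noncyclic_check m a b c e1 e2 e3 n qs k T steps j U prS prU SU l1 d1 prSU P prP
      PS l2 d2 prPS PU l3 d3 prPU PSU l4 d4 prPSU"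
  shows "\<exists>K E. cubic_number_field K \<and> elliptic_curve_over K E \<and>
    has_subgroup_isomorphic_to (mordell_weil_group K E)
      (integer_mod_group 2 \<times>\<times> integer_mod_group n \<times>\<times> integer_group)"
proof -
  obtain \<alpha> where "cubic_curve m \<alpha> a b c"
    using exists_cubic_curve[OF assms(1)] check unfolding noncyclic_check_def Let_def by blast
  then interpret cubic_curve m \<alpha> a b c .
  show ?thesis using cubic_number_field_K elliptic_curve noncyclic_case[OF check] by blast
qed

section \<open>Explicit fields, curves and points\<close>

lemma example_Z11_Z2:
  "\<exists>K E. cubic_number_field K \<and> elliptic_curve_over K E \<and>
    has_subgroup_isomorphic_to (mordell_weil_group K E) (integer_mod_group 11 \<times>\<times> integer_group \<times>\<times> integer_group)"
proof (rule odd_rank_two_example)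
  show "irreducible_check 5 (-2, 9, -8)" by (simp add: check_simps)
  \<comment> \<open>As 11 is prime, \<open>qs\<close> = [1] suffices; 5 T and 6 T are opposite. The
    reduction (11, 9) excludes points of order two, and the later ones exclude halves of P, Q and P
    + Q.\<close>
  show "odd_rank_two_check
    (-2, 9, -8) (320, -496, -23) (-896, 896, 1312) (3072, -8192, 9472) 11 [1] 5 ((0, 0, 0),
    (96, -176, -32)) [(1, 1, ((-256, 416, 48), (-1664, 2624, 256)), (-8, 5, 0), 1), (2, 1,
    ((0, 32, -16), (0, -512, 640)), (8, -3, 0), 1), (3, 2, ((-48, 88, 16), (512, -912, 232)),
    (4, 5, 0), 1), (3, 3, ((-48, 88, 16), (-512, 912, -232)), (-24, 35, 4), 1)] (11, 9) ((48,
    -40, 8), (-1008, 1832, -616)) (17, 13) ((-288, 384, 48), (-384, 352, 160)) (17, 13) ((-64,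
    80, 48), (1280, -3584, 2576)) (-4, 9, 0) 1 (47, 5)"
    by (simp add: check_simps)
qed

lemma example_Z13_Z:
  "\<exists>K E. cubic_number_field K \<and> elliptic_curve_over K E \<and>
    has_subgroup_isomorphic_to (mordell_weil_group K E) (integer_mod_group 13 \<times>\<times> integer_group)"
proof (rule odd_example)
  show "irreducible_check 3 (-2, 0, -1)" by (simp add: check_simps)
  show "odd_check
    (-2, 0, -1) (17, 12, 4) (32, 80, 32) (256, 256, 64) 13 [1] 6 ((0, 0, 0), (16, 8, 0)) [(1,
    1, ((-16, -8, 0), (0, 32, 16)), (1, 2, 0), 1), (2, 1, ((0, -8, 0), (-16, 0, -16)), (1, -2,
    0), 1), (3, 3, ((16, 8, 0), (-96, -80, -16)), (3, 2, -2), 1), (6, 1, ((16, 8, 0), (96, 80,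
    16)), (-7, -2, 0), 1)] (7, 2) ((0, -4, -4), (-16, 4, 12)) (17, 8)"
    by (simp add: check_simps)
qed

lemma example_Z15_Z:
  "\<exists>K E. cubic_number_field K \<and> elliptic_curve_over K E \<and>
    has_subgroup_isomorphic_to (mordell_weil_group K E) (integer_mod_group 15 \<times>\<times> integer_group)"
proof (rule odd_example)
  show "irreducible_check 7 (-3, 3, -1)" by (simp add: check_simps)
  show "odd_check
    (-3, 3, -1) (846, -162, -135) (209952, -49248, -41472) (26313984, -4478976, -3919104) 15
    [5, 3] 5 ((0, 0, 0), (5184, -432, -432)) [(1, 1, ((-432, 36, 36), (3564, -1620, -1296)),
    (21, -3, -3), 1), (2, 1, ((-432, 144, 144), (-2592, 1296, 0)), (3, 3, 3), 1), (3, 2,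
    ((-552, 144, 120), (648, 1344, 840)), (-9, 19, 7), 1), (5, 5, ((-552, 144, 120), (-648,
    -1344, -840)), (9, -21, -9), 1)] (17, 7) ((108, -180, -72), (-3240, 2916, 2268)) (23, 5)"
    by (simp add: check_simps)
qed

lemma example_Z16_Z:
  "\<exists>K E. cubic_number_field K \<and> elliptic_curve_over K E \<and>
    has_subgroup_isomorphic_to (mordell_weil_group K E) (integer_mod_group 16 \<times>\<times> integer_group)"
proof (rule cyclic_example)
  show "irreducible_check 5 (2, -1, -6)" by (simp add: check_simps)
  \<comment> \<open>8 T is the origin and its own opposite, which gives 16 T = 0. Every proper
    divisor of 16 divides 8, so the same point certifies the exact order.\<close>
  show "cyclic_check
    (2, -1, -6) (49, 8, -32) (-3072, 2048, 8960) 16 [8] 8 ((-8, 8, 16), (-24, 24, 48)) [(1, 1,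
    ((16, 32, 16), (-144, -288, -144)), (7, 4, 0), 1), (2, 2, ((0, 0, 16), (0, -64, 16)), (-9,
    -4, 0), 1), (4, 4, ((0, 0, 0), (0, 0, 0)), (-1, -12, -2), 1)] (11, 8) (11, 8) ((-8, -64,
    -8), (216, -192, -168)) (11, 8) ((-9, 8, 23), (54, -32, -154)) (2, -8, -1) 1 (13, 9)"
    by (simp add: check_simps)
qed

lemma example_Z20_Z:
  "\<exists>K E. cubic_number_field K \<and> elliptic_curve_over K E \<and>
    has_subgroup_isomorphic_to (mordell_weil_group K E) (integer_mod_group 20 \<times>\<times> integer_group)"
proof (rule cyclic_example)
  show "irreducible_check 7 (-30, 36, -9)" by (simp add: check_simps)
  show "cyclic_check
    (-30, 36, -9) (13417, -6324, -612) (2377216, -1150464, -110592) 20 [10, 4] 10 ((-416, 56,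
    8), (-44160, 20392, 1976)) [(1, 1, ((64, 192, 16), (-155520, 81600, 7760)), (287, -146,
    -14), 1), (2, 2, ((64, 0, 0), (25920, -11904, -1152)), (-397, 210, 20), 1), (4, 1,
    ((-3104, 1488, 144), (140832, -68400, -6576)), (179, -82, -8), 1), (5, 5, ((0, 0, 0), (0,
    0, 0)), (-243, 126, 12), 1)] (13, 11) (13, 11) ((654, -318, -29), (55500, -26860, -2570))
    (19, 12) ((-2144, 1036, 100), (91008, -44068, -4236)) (201, -94, -9) 1 (13, 11)"
    by (simp add: check_simps)
qed

lemma example_Z2_Z10_Z:
  "\<exists>K E. cubic_number_field K \<and> elliptic_curve_over K E \<and>
    has_subgroup_isomorphic_to (mordell_weil_group K E) (integer_mod_group 2 \<times>\<times> integer_mod_group 10 \<times>\<times> integer_group)"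
proof (rule noncyclic_example)
  show "irreducible_check 5 (-3, -15, -19)" by (simp add: check_simps)
  show "noncyclic_check
    (-3, -15, -19) (-116, -260, -23) (-2592, -2880, 6624) (0, 0, 0) (0, 0, 0) (-108, -252, -9)
    (224, 512, 32) 10 [5, 2] 5 ((-36, -84, 0), (-288, -660, -36)) [(1, 1, ((252, 576, 36),
    (-684, -1584, -108)), (16, 35, 2), 1), (2, 2, ((744, 1704, 96), (7584, 17448, 936)), (-94,
    -221, -12), 1), (4, 1, ((0, 0, 0), (0, 0, 0)), (64, 149, 8), 1)] 1 ((-36, -84, 0), (-288,
    -660, -36)) (13, 2) (13, 2) ((372, 852, 48), (2112, 4884, 324)) (-32, -76, -4) 1 (13, 2)
    ((-48, -108, 12), (-492, -1596, -1104)) (13, 2) ((288, 588, 36), (2124, 4476, 240)) (-4,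
    4, 0) 1 (13, 2) ((240, 550, 34), (-438, -1010, -56)) (11, 23, 1) 1 (13, 2) ((-12, -30, 2),
    (126, 306, 48)) (13, 17, 1) 1 (17, 14)"
    unfolding noncyclic_check_def Let_def list.pred_inject
    by (intro conjI; simp add: check_simps)
qed

lemma example_Z2_Z12_Z:
  "\<exists>K E. cubic_number_field K \<and> elliptic_curve_over K E \<and>
    has_subgroup_isomorphic_to (mordell_weil_group K E) (integer_mod_group 2 \<times>\<times> integer_mod_group 12 \<times>\<times> integer_group)"
proof (rule noncyclic_example)
  show "irreducible_check 3 (-2, -1, -1)" by (simp add: check_simps)
  show "noncyclic_check
    (-2, -1, -1) (123, -49, 14) (1152, 3136, 1728) (0, 0, 0) (0, 0, 0) (-128, 64, 0) (5, -15,
    -14) 12 [6, 4] 6 ((-56, 24, 48), (-120, -496, -304)) [(1, 1, ((144, 96, 16), (-2224,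
    -1776, -480)), (15, 6, 5), 1), (2, 2, ((16, 16, 4), (-232, -276, -92)), (-21, -4, -1), 1),
    (4, 2, ((0, 0, 0), (0, 0, 0)), (-17, -2, -1), 1)] 1 ((-56, 24, 48), (-120, -496, -304))
    (23, 12) (23, 12) ((560, 392, -16), (-15456, -14208, -2056)) (19, 10, -3) 1 (23, 12)
    ((-80, -80, 16), (-1360, 240, 400)) (23, 12) ((38, 97, 26), (690, 1115, 770)) (-7, -8, -4)
    1 (23, 12) ((120, 256, 120), (-568, 3352, 2736)) (-17, -10, -7) 1 (41, 12) ((-96, 0, 56),
    (432, 1144, 664)) (3, 12, 0) 1 (23, 12)"
    unfolding noncyclic_check_def Let_def list.pred_inject
    by (intro conjI; simp add: check_simps)
qed

text \<open>The curve and P are defined over \<rat>, whereas e1, e2 and e3 lie in K but not in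
  \<rat>, so K is the splitting field of the cubic. Since 7 is odd, U can be taken as 7 T = (e1, 0);
  then S, U and S + U are the three points of order two.\<close>

lemma example_Z2_Z14_Z:
  "\<exists>K E. cubic_number_field K \<and> elliptic_curve_over K E \<and>
    has_subgroup_isomorphic_to (mordell_weil_group K E) (integer_mod_group 2 \<times>\<times> integer_mod_group 14 \<times>\<times> integer_group)"
proof (rule noncyclic_example)
  show "irreducible_check 5 (536, 166, 1)" by (simp add: check_simps)
  show "noncyclic_check
    (536, 166, 1) (125316, 0, 0) (-274437275710946076645120, 0, 0)
    (55319731060053040407430335575396352, 0, 0) (-823868153472, -34142845464, 7524766308)
    (223283328564, -27795778038, -1928091090) (600584699592, 61938623502, -5596675218) 14 [7,
    2] 7 ((108452476512, 39020394816, -1000522944), (-232587702771024384, 6892796662667136,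
    -176738375965824)) [(1, 1, ((188494312032, -36018825984, 3001568832),
    (-154822817346061824, -44538070743387648, 3711505895282304)), (646758, 5664, -8496), 1),
    (2, 1, ((340073538048, 9755098704, -750392208), (34198875749386944, 8615995828333920,
    -662768909871840)), (627642, -56286, -3894), 1), (2, 2, ((338572753632, 13507059744,
    1500784416), (30752477418053376, 16701776528770368, 1855752947641152)), (693250, -96642,
    -2242), 1), (4, 3, ((-823868153472, -34142845464, 7524766308), (0, 0, 0)), (-201898,
    -25134, 8260), 1)] 7 ((-823868153472, -34142845464, 7524766308), (0, 0, 0)) (31, 15) (31,
    15) ((600584699592, 61938623502, -5596675218), (0, 0, 0)) (0, 0, 0) 1 (31, 15)
    ((310361615712, 0, 0), (6349984184973312, 0, 0)) (31, 15) ((-1202736434400, -174003687216,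
    18705625776), (1654864573187995776, 275166987004727136, -26325692437407840)) (76412,
    -100299, 6487) 1 (31, 15) ((674536200192, 109407227040, 942175872), (-421924730573512512,
    -138836277090418752, -6372625844676096)) (-18398, 17964, 6986) 1 (31, 15) ((2974960627200,
    64596460176, -19647801648), (-4759634717702579520, -136330709914308384,
    32698318282083936)) (2154682, 182634, -19960) 1 (31, 18)"
    unfolding noncyclic_check_def Let_def list.pred_inject
    by (intro conjI; simp add: check_simps)
qed

theorem theorem3p3:
  shows
    "(\<exists>K E. cubic_number_field K \<and> elliptic_curve_over K E \<and>
        has_subgroup_isomorphic_to (mordell_weil_group K E)
          (integer_mod_group 11 \<times>\<times> integer_group \<times>\<times> integer_group)) \<and>
     (\<exists>K E. cubic_number_field K \<and> elliptic_curve_over K E \<and>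
        has_subgroup_isomorphic_to (mordell_weil_group K E)
          (integer_mod_group 13 \<times>\<times> integer_group)) \<and>
     (\<exists>K E. cubic_number_field K \<and> elliptic_curve_over K E \<and>
        has_subgroup_isomorphic_to (mordell_weil_group K E)
          (integer_mod_group 15 \<times>\<times> integer_group)) \<and>
     (\<exists>K E. cubic_number_field K \<and> elliptic_curve_over K E \<and>
        has_subgroup_isomorphic_to (mordell_weil_group K E)
          (integer_mod_group 16 \<times>\<times> integer_group)) \<and>
     (\<exists>K E. cubic_number_field K \<and> elliptic_curve_over K E \<and>
        has_subgroup_isomorphic_to (mordell_weil_group K E)
          (integer_mod_group 20 \<times>\<times> integer_group)) \<and>
     (\<exists>K E. cubic_number_field K \<and> elliptic_curve_over K E \<and>
        has_subgroup_isomorphic_to (mordell_weil_group K E)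
          (integer_mod_group 2 \<times>\<times> integer_mod_group 10 \<times>\<times> integer_group)) \<and>
     (\<exists>K E. cubic_number_field K \<and> elliptic_curve_over K E \<and>
        has_subgroup_isomorphic_to (mordell_weil_group K E)
          (integer_mod_group 2 \<times>\<times> integer_mod_group 12 \<times>\<times> integer_group)) \<and>
     (\<exists>K E. cubic_number_field K \<and> elliptic_curve_over K E \<and>
        has_subgroup_isomorphic_to (mordell_weil_group K E)
          (integer_mod_group 2 \<times>\<times> integer_mod_group 14 \<times>\<times> integer_group))"
  by (intro conjI example_Z11_Z2 example_Z13_Z example_Z15_Z example_Z16_Z example_Z20_Z
      example_Z2_Z10_Z example_Z2_Z12_Z example_Z2_Z14_Z)

end
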